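(* There exist $R>1$ and $\lambda_0>0$ such that for every $\lambda\ge\lambda_0$ and every maximizer $\omega^\lambda$ of $E$ over $K_\lambda$, writing $\omega_i^\lambda=\omega^\lambda I_{B_i}$ and $\varepsilon_i=\sqrt{\frac{|\kappa_i|}{\lambda\pi}}$, $$\mathrm{diam}\big(\mathrm{supp}(\omega_i^\lambda)\big)<R\,\varepsilon_i,\qquad i=1,2.$$
   Context: $D\subset\mathbb R^2$ is a bounded simply connected domain with smooth boundary; $G$ is the Green function of $-\Delta$ in $D$ with zero Dirichlet boundary condition, written $G(x,y)=\frac1{2\pi}\ln\frac1{|x-y|}-h(x,y)$, where $h$ is the regular part. Real numbers $\kappa_1>0$ and $\kappa_2<0$ are fixed, and the Kirchhoff–Routh function is $H(x_1,x_2)=-2\kappa_1\kappa_2G(x_1,x_2)+\sum_{i=1}^2\kappa_i^2h(x_i,x_i)$ for $x_1,x_2\in D$, $x_1\ne x_2$. The point $(\bar x_1,\bar x_2)\in D\times D$, $\bar x_1\neq\bar x_2$, is a strict local minimum point of $H$. A number $\delta>0$ is fixed so small that, writing $B_i=B_\delta(\bar x_i)$: $\overline{B_i}\subset D$ for $i=1,2$; $\overline{B_1}\cap\overline{B_2}=\varnothing$; and $(\bar x_1,\bar x_2)$ is the unique minimum point of $H$ in $\overline{B_1}\times\overline{B_2}$. For $\lambda>0$, $K_\lambda$ is the set of all $\omega=\omega_1+\omega_2$ with $\omega_i\in L^\infty(D)$, $0\le \mathrm{sgn}(\kappa_i)\omega_i\le\lambda$ a.e., $\int_D\omega_i=\kappa_i$,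 and $\omega_i$ supported in $B_i$ (meaning $\omega_i=0$ a.e. in $D\setminus B_i$), $i=1,2$. The kinetic energy is $E(\omega)=\frac12\int_D\int_DG(x,y)\omega(x)\omega(y)\,dx\,dy$. A maximizer $\omega^\lambda$ of $E$ over $K_\lambda$ exists whenever $K_\lambda\neq\varnothing$. $I_A$ denotes the characteristic function of $A$ and $\mathrm{supp}$ the (essential) support. Put $\psi^\lambda(x)=\int_DG(x,y)\omega^\lambda(y)\,dy$. If $\lambda\pi\delta^2>\max(|\kappa_1|,|\kappa_2|)$, every maximizer $\omega^\lambda$ of $E$ over $K_\lambda$ satisfies $\omega^\lambda I_{B_i}=\mathrm{sgn}(\kappa_i)\lambda I_{\Omega_i}$ a.e. with $\Omega_i=\{\mathrm{sgn}(\kappa_i)\psi^\lambda>\mu_i^\lambda\}\cap B_i$ for uniquely determined real numbers $\mu_i^\lambda$, $i=1,2$. The number $\delta$ is moreover chosen so small that $\mu_1^\lambda>0$ and $\mu_2^\lambda>0$ for every maximizer $\omega^\lambda$ and all sufficiently large $\lambda$ (such a choice is possible). *)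

theory Defs
  imports "HOL-Analysis.Analysis"
begin

definition partial :: "'a::euclidean_space \<Rightarrow> ('a \<Rightarrow> real) \<Rightarrow> 'a \<Rightarrow> real" where
  "partial b f x = frechet_derivative f (at x) b"

text \<open>\<open>C_on k S f\<close>: \<open>f\<close> is \<open>k\<close> times continuously differentiable on \<open>S\<close>.
  Meaningful for open \<open>S\<close> only, since the derivatives are unrestricted ones.\<close>

fun C_on :: "nat \<Rightarrow> 'a::euclidean_space set \<Rightarrow> ('a \<Rightarrow> real) \<Rightarrow> bool" where
  "C_on 0 S f \<longleftrightarrow> continuous_on S f"
| "C_on (Suc k) S f \<longleftrightarrow>
     (\<forall>x\<in>S. f differentiable (at x)) \<and> (\<forall>b\<in>Basis. C_on k S (partial b f))"

definition laplacian :: "('a::euclidean_space \<Rightarrow> real) \<Rightarrow> 'a \<Rightarrow> real" where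
  "laplacian f x = (\<Sum>b\<in>Basis. partial b (partial b f) x)"

definition harmonic_on :: "'a::euclidean_space set \<Rightarrow> ('a \<Rightarrow> real) \<Rightarrow> bool" where
  "harmonic_on S f \<longleftrightarrow> C_on 2 S f \<and> (\<forall>x\<in>S. laplacian f x = 0)"

text \<open>Near each boundary point \<open>D\<close> is the sublevel set of a \<open>C\<^sup>\<infinity>\<close> function with
  nonvanishing gradient (so \<open>D\<close> lies locally on one side of its boundary).\<close>

definition smooth_boundary :: "'a::euclidean_space set \<Rightarrow> bool" where
  "smooth_boundary D \<longleftrightarrow>
     (\<forall>p\<in>frontier D. \<exists>U \<phi>. open U \<and> p \<in> U \<and> (\<forall>k. C_on k U \<phi>) \<and>
        (\<exists>b\<in>Basis. partial b \<phi> p \<noteq> 0) \<and> D \<inter> U = {x \<in> U. \<phi> x < 0})"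

text \<open>\<open>G\<close> is the Dirichlet Green function of \<open>-\<Delta>\<close> in \<open>D\<close> and \<open>h\<close> its regular part; the first
  argument is the pole. The value of \<open>G\<close> on the diagonal is left unspecified.\<close>

definition green_function ::
    "(real^2) set \<Rightarrow> (real^2 \<Rightarrow> real^2 \<Rightarrow> real) \<Rightarrow> (real^2 \<Rightarrow> real^2 \<Rightarrow> real) \<Rightarrow> bool" where
  "green_function D G h \<longleftrightarrow>
     (\<forall>x\<in>D. harmonic_on D (h x) \<and> continuous_on (closure D) (h x) \<and>
        (\<forall>y \<in> closure D - {x}. G x y = 1 / (2 * pi) * ln (1 / norm (x - y)) - h x y) \<and>
        (\<forall>y \<in> frontier D. G x y = 0))"

definition kirchhoff_routh ::
    "(real^2 \<Rightarrow> real^2 \<Rightarrow> real) \<Rightarrow> (real^2 \<Rightarrow> real^2 \<Rightarrow> real) \<Rightarrow> real \<Rightarrow> real \<Rightarrow>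
     real^2 \<Rightarrow> real^2 \<Rightarrow> real" where
  "kirchhoff_routh G h \<kappa>1 \<kappa>2 x1 x2 =
     - 2 * \<kappa>1 * \<kappa>2 * G x1 x2 + (\<kappa>1\<^sup>2 * h x1 x1 + \<kappa>2\<^sup>2 * h x2 x2)"

text \<open>Elements of \<open>L\<^sup>\<infinity>(D)\<close> are represented by functions on the whole plane whose values
  outside \<open>D\<close> are irrelevant.\<close>

definition L_infinity :: "(real^2) set \<Rightarrow> (real^2 \<Rightarrow> real) set" where
  "L_infinity D = {f \<in> borel_measurable (lebesgue_on D).
     \<exists>C. AE x in lebesgue_on D. \<bar>f x\<bar> \<le> C}"

definition signed_vorticities ::
    "(real^2) set \<Rightarrow> (real^2) set \<Rightarrow> real \<Rightarrow> real \<Rightarrow> (real^2 \<Rightarrow> real) set" where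
  "signed_vorticities D B \<kappa> lam = {w \<in> L_infinity D.
     (AE x in lebesgue_on D. 0 \<le> sgn \<kappa> * w x \<and> sgn \<kappa> * w x \<le> lam) \<and>
     (LINT x|lebesgue_on D. w x) = \<kappa> \<and>
     (AE x in lebesgue_on D. x \<notin> B \<longrightarrow> w x = 0)}"

definition admissible ::
    "(real^2) set \<Rightarrow> (real^2) set \<Rightarrow> (real^2) set \<Rightarrow> real \<Rightarrow> real \<Rightarrow> real \<Rightarrow> (real^2 \<Rightarrow> real) set" where
  "admissible D B1 B2 \<kappa>1 \<kappa>2 lam =
     {(\<lambda>x. w1 x + w2 x) | w1 w2.
        w1 \<in> signed_vorticities D B1 \<kappa>1 lam \<and> w2 \<in> signed_vorticities D B2 \<kappa>2 lam}"

definition kinetic_energy ::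
    "(real^2) set \<Rightarrow> (real^2 \<Rightarrow> real^2 \<Rightarrow> real) \<Rightarrow> (real^2 \<Rightarrow> real) \<Rightarrow> real" where
  "kinetic_energy D G w =
     1 / 2 * (LINT x|lebesgue_on D. LINT y|lebesgue_on D. G x y * w x * w y)"

definition energy_maximizer ::
    "(real^2) set \<Rightarrow> (real^2 \<Rightarrow> real^2 \<Rightarrow> real) \<Rightarrow> (real^2) set \<Rightarrow> (real^2) set \<Rightarrow>
     real \<Rightarrow> real \<Rightarrow> real \<Rightarrow> (real^2 \<Rightarrow> real) \<Rightarrow> bool" where
  "energy_maximizer D G B1 B2 \<kappa>1 \<kappa>2 lam w \<longleftrightarrow>
     w \<in> admissible D B1 B2 \<kappa>1 \<kappa>2 lam \<and>
     (\<forall>v \<in> admissible D B1 B2 \<kappa>1 \<kappa>2 lam. kinetic_energy D G v \<le> kinetic_energy D G w)"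

definition stream_function ::
    "(real^2) set \<Rightarrow> (real^2 \<Rightarrow> real^2 \<Rightarrow> real) \<Rightarrow> (real^2 \<Rightarrow> real) \<Rightarrow> real^2 \<Rightarrow> real" where
  "stream_function D G w x = (LINT y|lebesgue_on D. G x y * w y)"

text \<open>For a maximizer \<open>w\<close> and \<open>lam\<close> large there is exactly one such \<open>\<mu>\<close> for each of the two
  balls \<open>B\<close>.\<close>

definition patch_level ::
    "(real^2) set \<Rightarrow> (real^2 \<Rightarrow> real^2 \<Rightarrow> real) \<Rightarrow> (real^2) set \<Rightarrow> real \<Rightarrow> real \<Rightarrow>
     (real^2 \<Rightarrow> real) \<Rightarrow> real \<Rightarrow> bool" where
  "patch_level D G B \<kappa> lam w \<mu> \<longleftrightarrow>
     (AE x in lebesgue_on D. w x * indicator B x =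
        sgn \<kappa> * lam * indicator ({z. sgn \<kappa> * stream_function D G w z > \<mu>} \<inter> B) x)"

definition ess_support :: "(real^2) set \<Rightarrow> (real^2 \<Rightarrow> real) \<Rightarrow> (real^2) set" where
  "ess_support D f =
     {x \<in> D. \<forall>r>0. \<not> (AE y in lebesgue_on D. y \<in> ball x r \<longrightarrow> f y = 0)}"

end

theory Submission
  imports Defs
begin

text \<open>
  Freeze one vortex and write the other one as \<open>f\<close>, with mass \<open>m\<close>, density bound \<open>lam\<close> and
  \<open>lam \<pi> e\<^sup>2 = m\<close>. By the maximum principle \<open>h\<close> is bounded on the discs (and continuous there, being
  Lipschitz in the pole), and the two discs are separated, so the energy is the logarithmic self-energy
  of \<open>f\<close> up to a term that is Lipschitz in the \<open>L\<^sup>1\<close> norm. Hence \<open>f\<close> almost maximizes its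
  self-energy, with an error \<open>C \<parallel>v - f\<parallel>\<^sub>1\<close> when compared with \<open>v\<close>.

  Let \<open>U\<close> be the potential of \<open>f\<close> for the rescaled kernel \<open>ln (e / |x - y|)\<close>. Comparison with a disc of
  radius \<open>e\<close> gives a point \<open>x\<^sub>0\<close> where \<open>U\<close> is bounded below independently of \<open>e\<close>; then \<open>U\<close> is also
  bounded below on \<open>B(x\<^sub>0, 3e)\<close>, a disc too large to be filled by the patch. Moving a little mass there
  from a neighbourhood of a point of the support shows that \<open>U\<close> is bounded below on a dense part of the
  support. At a point where this holds, more than half of the mass lies within distance \<open>R e\<close>, for
  \<open>R\<close> large, because mass further away contributes at most \<open>- ln R\<close> per unit; two such discs must meet.
\<close>

section \<open>Logarithmic potentials and energies\<close>

text \<open>The constants must be uniform in \<open>lam\<close>, whereas the self-energy for the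
  kernel ln (1 / |x - y|) grows like m^2 ln (1 / e). Writing \<open>e\<close> in place of 1 shifts
  the self-energy of every density of mass m by the same \<open>ln e * m^2\<close>, so comparisons
  survive and all later bounds involve only m and C. The positive part \<open>log_pole\<close> has
  integral at most 2 pi e^2, hence contributes at most 2 lam pi e^2 = 2 m to the potential of a
  density below \<open>lam\<close>. The error has to be proportional to the L1 distance, because the
  mass that can be moved is arbitrarily small. Moving mass t \<alpha> changes the density by 2 t
  \<alpha> in L1, and the first variation carries the same factor 2 t. After division the error is C
  per unit of mass, and the quadratic term vanishes with t. The radius 3 e comes from the edge of
  the vortex disc: only a disc of radius 3 e / 2 is sure to lie both in B(x0, 3 e) and in the vortex
  disc. Filled at density lam / 2 it would hold 9 m / 8 > m, so some room is left to receive
  mass.\<close>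

definition log_pole :: "real \<Rightarrow> real^2 \<Rightarrow> real^2 \<Rightarrow> real" where
  "log_pole e x y = max 0 (ln (e / dist x y))"

lemma log_pole_measurable [measurable]:
  "(\<lambda>p. log_pole e (fst p) (snd p)) \<in> borel_measurable (borel \<Otimes>\<^sub>M borel)"
  "log_pole e x \<in> borel_measurable borel"
  unfolding log_pole_def by measurable

lemma log_pole_nonneg: "0 \<le> log_pole e x y"
  by (simp add: log_pole_def)

lemma emeasure_ball_plane:
  "0 \<le> r \<Longrightarrow> emeasure lborel (ball (c :: real^2) r) = ennreal (pi * r\<^sup>2)"
  by (simp add: emeasure_ball unit_ball_vol_2)

lemma emeasure_cball_less_top: "emeasure lborel (cball (c :: real^2) r) < top"
  using emeasure_lborel_cball_finite[of c r] by (simp add: less_top)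

text \<open>A discrete layer-cake bound: a positive value t of \<open>log_pole\<close> is at most
  the number of n with n < t, and each such n satisfies dist x y < e exp (-n), so \<open>y\<close>
  lies in the n-th ball.\<close>

lemma log_pole_le_suminf:
  assumes "0 < e"
  shows "ennreal (log_pole e x y) \<le> (\<Sum>n. indicator (ball x (e * exp (- real n))) y)"
proof (cases "log_pole e x y = 0")
  case False
  define t where "t = ln (e / dist x y)"
  have t: "log_pole e x y = t" "0 < t"
    using False by (auto simp: log_pole_def t_def max_def split: if_splits)
  \<comment> \<open>Division by zero and \<open>ln 0\<close> both yield 0, so a positive logarithm
    excludes x = y.\<close>
  then have d: "0 < dist x y"
    unfolding t_def by (metis div_by_0 ln_0 less_irrefl zero_less_dist_iff dist_eq_0_iff)
  have exp_t: "exp t = e / dist x y"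
    unfolding t_def using d assms by simp
  define N where "N = nat \<lceil>t\<rceil>"
  have "ennreal t \<le> ennreal (real N)"
    unfolding N_def by (intro ennreal_leI) linarith
  also have "\<dots> = (\<Sum>n<N. 1)"
    by (simp add: ennreal_of_nat_eq_real_of_nat)
  also have "\<dots> = (\<Sum>n<N. indicator (ball x (e * exp (- real n))) y)"
  proof (rule sum.cong)
    fix n assume "n \<in> {..<N}"
    then have "real n < t"
      unfolding N_def by auto linarith
    then have "exp (real n) < e / dist x y"
      unfolding exp_t[symmetric] by simp
    then have "dist x y < e * exp (- real n)"
      using d by (simp add: exp_minus field_simps)
    then show "1 = (indicator (ball x (e * exp (- real n))) y :: ennreal)"
      by simp
  qed simp
  also have "\<dots> \<le> (\<Sum>n. indicator (ball x (e * exp (- real n))) y)"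
    by (intro sum_le_suminf) auto
  finally show ?thesis
    using t by simp
qed simp

text \<open>The areas of the balls in the layer-cake bound form a geometric series with ratio exp
  (-2), which is at most 1 / 2; this is the source of the factor 2.\<close>

lemma nn_integral_log_pole:
  assumes "0 < e"
  shows "(\<integral>\<^sup>+y. ennreal (log_pole e x y) \<partial>lborel) \<le> ennreal (2 * (pi * e\<^sup>2))"
proof -
  define q where "q = exp (- 2 :: real)"
  have "(3::real) \<le> exp 2"
    using exp_ge_add_one_self[of 2] by simp
  then have q: "0 < q" "q \<le> 1 / 2" "q < 1"
    unfolding q_def by (auto simp: exp_minus field_simps)
  have pow: "(exp (- real n))\<^sup>2 = q ^ n" for n
    unfolding q_def by (simp add: exp_of_nat_mult[symmetric] power2_eq_square exp_add[symmetric])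
  have sums: "(\<lambda>n. pi * e\<^sup>2 * q ^ n) sums (pi * e\<^sup>2 * (1 / (1 - q)))"
    using q by (intro sums_mult geometric_sums) auto
  have "(\<integral>\<^sup>+y. ennreal (log_pole e x y) \<partial>lborel)
      \<le> (\<integral>\<^sup>+y. (\<Sum>n. indicator (ball x (e * exp (- real n))) y) \<partial>lborel)"
    by (intro nn_integral_mono log_pole_le_suminf assms)
  also have "\<dots> = (\<Sum>n. \<integral>\<^sup>+y. indicator (ball x (e * exp (- real n))) y \<partial>lborel)"
    by (rule nn_integral_suminf) (auto intro!: borel_measurable_indicator)
  also have "\<dots> = (\<Sum>n. ennreal (pi * e\<^sup>2 * q ^ n))"
    using assms by (simp add: emeasure_ball_plane power_mult_distrib pow mult.assoc)
  also have "\<dots> = ennreal (pi * e\<^sup>2 * (1 / (1 - q)))"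
    using q by (intro suminf_ennreal_eq sums) auto
  also have "\<dots> \<le> ennreal (2 * (pi * e\<^sup>2))"
  proof -
    have "1 / (1 - q) \<le> 2"
      using q by (simp add: field_simps)
    then have "pi * e\<^sup>2 * (1 / (1 - q)) \<le> pi * e\<^sup>2 * 2"
      by (intro mult_left_mono) auto
    then show ?thesis
      by (intro ennreal_leI) (simp add: mult.commute)
  qed
  finally show ?thesis .
qed

lemma integrable_log_pole:
  assumes "0 < e"
  shows "integrable lborel (log_pole e x)"
    and "(\<integral>y. log_pole e x y \<partial>lborel) \<le> 2 * (pi * e\<^sup>2)"
proof -
  show "integrable lborel (log_pole e x)"
    using nn_integral_log_pole[OF assms, of x] 
    by (intro integrableI_nonneg)
      (auto simp: log_pole_nonneg intro: le_less_trans)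
  then show "(\<integral>y. log_pole e x y \<partial>lborel) \<le> 2 * (pi * e\<^sup>2)"
    using nn_integral_log_pole[OF assms, of x] 
    by (subst (asm) nn_integral_eq_integral) (auto simp: log_pole_nonneg)
qed

section \<open>Bounded Borel functions of bounded support, the class on which all integrals
  converge\<close>

definition bdd_bsupp :: "(real^2 \<Rightarrow> real) \<Rightarrow> bool" where
  "bdd_bsupp f \<longleftrightarrow> f \<in> borel_measurable borel \<and> (\<exists>M r. \<forall>x. \<bar>f x\<bar> \<le> M * indicator (cball 0 r) x)"

lemma bdd_bsuppI:
  assumes "f \<in> borel_measurable borel" "\<And>x. \<bar>f x\<bar> \<le> M" "\<And>x. x \<notin> S \<Longrightarrow> f x = 0" "bounded S"
  shows "bdd_bsupp f"
proof -
  obtain r where "\<forall>x\<in>S. norm x \<le> r"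
    using assms(4) bounded_iff by blast
  then have "\<bar>f x\<bar> \<le> M * indicator (cball 0 r) x" for x
    using assms(2)[of x] assms(3)[of x] by (cases "x \<in> S") (auto simp: indicator_def)
  then show ?thesis
    unfolding bdd_bsupp_def using assms(1) by blast
qed

lemma bdd_bsupp_measurable [measurable_dest]: "bdd_bsupp f \<Longrightarrow> f \<in> borel_measurable borel"
  by (simp add: bdd_bsupp_def)

lemma bdd_bsuppE:
  assumes "bdd_bsupp f"
  obtains M r where "0 < M" "0 < r" "\<And>x. \<bar>f x\<bar> \<le> M * indicator (cball 0 r) x" "\<And>x. \<bar>f x\<bar> \<le> M"
proof -
  obtain M r where M: "\<And>x. \<bar>f x\<bar> \<le> M * indicator (cball 0 r) x"
    using assms unfolding bdd_bsupp_def by auto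
  have bound: "\<bar>f x\<bar> \<le> max 1 M * indicator (cball 0 (max 1 r)) x" for x
    using M[of x] by (cases "norm x \<le> r") auto
  moreover have "\<bar>f x\<bar> \<le> max 1 M" for x
    using M[of x] by (cases "norm x \<le> r") auto
  ultimately show ?thesis
    by (intro that[of "max 1 M" "max 1 r"]) auto
qed

text \<open>The factor \<open>g\<close> is only required to be locally bounded, since logarithmic
  potentials are unbounded at infinity.\<close>

lemma bdd_bsupp_mult:
  assumes "bdd_bsupp f" "g \<in> borel_measurable borel" "\<And>r. \<exists>M. \<forall>x\<in>cball 0 r. \<bar>g x\<bar> \<le> M"
  shows "bdd_bsupp (\<lambda>x. g x * f x)"
proof -
  obtain M r where M: "0 < M" "\<And>x. \<bar>f x\<bar> \<le> M * indicator (cball 0 r) x"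
    by (rule bdd_bsuppE[OF assms(1)]) blast
  obtain N where N: "\<forall>x\<in>cball 0 r. \<bar>g x\<bar> \<le> N"
    using assms(3) by blast
  have "\<bar>g x * f x\<bar> \<le> (N * M) * indicator (cball 0 r) x" for x
  proof (cases "x \<in> cball 0 r")
    case True
    then have "\<bar>g x\<bar> * \<bar>f x\<bar> \<le> N * M"
      using M(2)[of x] N by (intro mult_mono) (auto intro: order_trans[OF abs_ge_zero])
    with True show ?thesis by (simp add: abs_mult)
  next
    case False
    then show ?thesis using M(2)[of x] by simp
  qed
  moreover have "(\<lambda>x. g x * f x) \<in> borel_measurable borel"
    using assms(1,2) unfolding bdd_bsupp_def by (intro borel_measurable_times) auto
  ultimately show ?thesis
    unfolding bdd_bsupp_def by blast
qed

lemma bdd_bsupp_cmult: "bdd_bsupp f \<Longrightarrow> bdd_bsupp (\<lambda>x. c * f x)"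
  by (rule bdd_bsupp_mult) auto

lemma bdd_bsupp_add:
  assumes "bdd_bsupp f" "bdd_bsupp g"
  shows "bdd_bsupp (\<lambda>x. f x + g x)"
proof -
  obtain M r where M: "0 < M" "\<And>x. \<bar>f x\<bar> \<le> M * indicator (cball 0 r) x"
    by (rule bdd_bsuppE[OF assms(1)]) blast
  obtain N s where N: "0 < N" "\<And>x. \<bar>g x\<bar> \<le> N * indicator (cball 0 s) x"
    by (rule bdd_bsuppE[OF assms(2)]) blast
  have "\<bar>f x + g x\<bar> \<le> (M + N) * indicator (cball 0 (max r s)) x" for x
    using M(1) N(1) M(2)[of x] N(2)[of x] abs_triangle_ineq[of "f x" "g x"]
    by (cases "norm x \<le> r"; cases "norm x \<le> s") auto
  moreover have "(\<lambda>x. f x + g x) \<in> borel_measurable borel"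
    using assms unfolding bdd_bsupp_def by (intro borel_measurable_add) auto
  ultimately show ?thesis
    unfolding bdd_bsupp_def by blast
qed

lemma bdd_bsupp_uminus: "bdd_bsupp f \<Longrightarrow> bdd_bsupp (\<lambda>x. - f x)"
  using bdd_bsupp_cmult[of f "-1"] by simp

lemma bdd_bsupp_diff: "bdd_bsupp f \<Longrightarrow> bdd_bsupp g \<Longrightarrow> bdd_bsupp (\<lambda>x. f x - g x)"
  using bdd_bsupp_add[OF _ bdd_bsupp_uminus, of f g] by simp

lemma bdd_bsupp_abs: "bdd_bsupp f \<Longrightarrow> bdd_bsupp (\<lambda>x. \<bar>f x\<bar>)"
  unfolding bdd_bsupp_def by auto

lemma bdd_bsupp_integrable:
  assumes "bdd_bsupp f"
  shows "integrable lborel f"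
proof -
  obtain M r where M: "0 < M" "\<And>x. \<bar>f x\<bar> \<le> M * indicator (cball 0 r) x"
    by (rule bdd_bsuppE[OF assms]) blast
  show ?thesis
  proof (rule Bochner_Integration.integrable_bound[where f="\<lambda>x. M * indicator (cball 0 r) x"])
    show "integrable lborel (\<lambda>x. M * indicator (cball (0::real^2) r) x)"
      by (intro integrable_mult_right integrable_real_indicator) (auto simp: emeasure_cball_less_top)
    show "f \<in> borel_measurable lborel"
      using assms by (simp add: bdd_bsupp_def)
    show "AE x in lborel. norm (f x) \<le> norm (M * indicator (cball 0 r) x)"
      using M by (intro AE_I2) (auto intro: order_trans)
  qed
qed

text \<open>On the diagonal the value is \<open>ln (e / 0) = 0\<close>, which is harmless below because points are null sets.\<close>

definition log_kernel :: "real \<Rightarrow> real^2 \<Rightarrow> real^2 \<Rightarrow> real" where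
  "log_kernel e x y = ln (e / dist x y)"

lemma log_kernel_measurable [measurable]:
  "(\<lambda>p. log_kernel e (fst p) (snd p)) \<in> borel_measurable (borel \<Otimes>\<^sub>M borel)"
  "log_kernel e x \<in> borel_measurable borel"
  unfolding log_kernel_def by measurable

lemma log_kernel_commute: "log_kernel e x y = log_kernel e y x"
  by (simp add: log_kernel_def dist_commute)

lemma log_kernel_le_pole: "log_kernel e x y \<le> log_pole e x y"
  by (simp add: log_kernel_def log_pole_def)

text \<open>The negative part ln (dist x y / e) is estimated by dist x y / e. This is crude, but it
  suffices for integrability against functions of bounded support.\<close>

lemma abs_log_kernel_le:
  assumes "0 < e"
  shows "\<bar>log_kernel e x y\<bar> \<le> log_pole e x y + dist x y / e"
proof (cases "x = y")
  case False
  then have "- ln (e / dist x y) \<le> dist x y / e"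
    using ln_le_minus_one[of "dist x y / e"] assms by (simp add: ln_div)
  then show ?thesis
    using assms by (auto simp: log_kernel_def log_pole_def max_def abs_real_def intro: add_nonneg_nonneg)
qed (simp add: log_kernel_def log_pole_def)

lemma abs_log_kernel_mult_le:
  assumes "0 < e" "\<And>y. \<bar>f y\<bar> \<le> M * indicator (cball 0 r) y" "norm x \<le> s" "0 \<le> s" "0 < M" "0 < r"
  shows "\<bar>log_kernel e x y * f y\<bar> \<le> M * log_pole e x y + M * ((s + r) / e) * indicator (cball 0 r) y"
proof (cases "y \<in> cball 0 r")
  case True
  have "dist x y / e \<le> (s + r) / e"
    using True assms by (intro divide_right_mono) (auto simp: dist_norm intro: order_trans[OF norm_triangle_ineq4])
  then have "\<bar>log_kernel e x y\<bar> \<le> log_pole e x y + (s + r) / e"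
    using abs_log_kernel_le[OF assms(1), of x y] by linarith
  then have "\<bar>log_kernel e x y\<bar> * \<bar>f y\<bar> \<le> (log_pole e x y + (s + r) / e) * M"
    using assms(2)[of y] True by (intro mult_mono) auto
  with True show ?thesis
    by (simp add: abs_mult algebra_simps)
next
  case False
  then show ?thesis
    using assms(2)[of y] assms log_pole_nonneg[of e x y] by simp
qed

lemma integrable_log_kernel_mult:
  assumes "0 < e" "bdd_bsupp f"
  shows "integrable lborel (\<lambda>y. log_kernel e x y * f y)"
proof -
  obtain M r where M: "0 < M" "0 < r" "\<And>x. \<bar>f x\<bar> \<le> M * indicator (cball 0 r) x"
    by (rule bdd_bsuppE[OF assms(2)]) blast
  show ?thesis
  proof (rule Bochner_Integration.integrable_bound)
    show "integrable lborel (\<lambda>y. M * log_pole e x y + M * ((norm x + r) / e) * indicator (cball 0 r) y)"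
      by (intro Bochner_Integration.integrable_add integrable_mult_right integrable_log_pole assms
          integrable_real_indicator) (auto simp: emeasure_cball_less_top)
    show "(\<lambda>y. log_kernel e x y * f y) \<in> borel_measurable lborel"
      using bdd_bsupp_measurable[OF assms(2)] by measurable
    show "AE y in lborel. norm (log_kernel e x y * f y)
        \<le> norm (M * log_pole e x y + M * ((norm x + r) / e) * indicator (cball 0 r) y)"
      using abs_log_kernel_mult_le[OF assms(1) M(3) order_refl norm_ge_zero M(1,2), of x]
      by (intro AE_I2) (metis abs_ge_self order_trans real_norm_def)
  qed
qed

definition log_potential :: "real \<Rightarrow> (real^2 \<Rightarrow> real) \<Rightarrow> real^2 \<Rightarrow> real" where
  "log_potential e f x = (\<integral>y. log_kernel e x y * f y \<partial>lborel)"

lemma log_potential_measurable: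
  assumes "bdd_bsupp f"
  shows "log_potential e f \<in> borel_measurable borel"
proof -
  have [measurable]: "f \<in> borel_measurable borel"
    using assms by (rule bdd_bsupp_measurable)
  have "(\<lambda>x. \<integral>y. log_kernel e (fst (x, y)) (snd (x, y)) * f y \<partial>lborel) \<in> borel_measurable borel"
    by (rule lborel.borel_measurable_lebesgue_integral) measurable
  then show ?thesis
    by (simp add: log_potential_def[abs_def])
qed

lemma log_potential_bounded:
  assumes "0 < e" "bdd_bsupp f"
  shows "\<exists>N. \<forall>x\<in>cball 0 s. \<bar>log_potential e f x\<bar> \<le> N"
proof -
  obtain M r where M: "0 < M" "0 < r" "\<And>x. \<bar>f x\<bar> \<le> M * indicator (cball 0 r) x"
    by (rule bdd_bsuppE[OF assms(2)]) blast
  define N where "N = M * (2 * (pi * e\<^sup>2)) + M * ((s + r) / e) * measure lborel (cball (0 :: real^2) r)"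
  have "\<bar>log_potential e f x\<bar> \<le> N" if x: "x \<in> cball 0 s" for x
  proof -
    have s: "norm x \<le> s" "0 \<le> s"
      using x by (auto intro: order_trans[OF norm_ge_zero])
    have "\<bar>log_potential e f x\<bar> \<le> (\<integral>y. \<bar>log_kernel e x y * f y\<bar> \<partial>lborel)"
      unfolding log_potential_def by (rule integral_abs_bound)
    also have "\<dots> \<le> (\<integral>y. M * log_pole e x y + M * ((s + r) / e) * indicator (cball 0 r) y \<partial>lborel)"
      using abs_log_kernel_mult_le[OF assms(1) M(3) s M(1,2)]
      by (intro integral_mono integrable_abs integrable_log_kernel_mult assms
          Bochner_Integration.integrable_add integrable_mult_right integrable_log_pole
          integrable_real_indicator) (auto simp: emeasure_cball_less_top)
    also have "\<dots> = M * (\<integral>y. log_pole e x y \<partial>lborel) + M * ((s + r) / e) * measure lborel (cball (0 :: real^2) r)"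
      using assms(1) by (subst Bochner_Integration.integral_add) 
        (auto simp: integrable_log_pole emeasure_cball_less_top intro!: integrable_real_indicator)
    also have "\<dots> \<le> N"
      unfolding N_def using integrable_log_pole(2)[OF assms(1), of x] M(1) by simp
    finally show ?thesis .
  qed
  then show ?thesis by blast
qed

lemma bdd_bsupp_potential_mult:
  assumes "0 < e" "bdd_bsupp f" "bdd_bsupp g"
  shows "bdd_bsupp (\<lambda>x. log_potential e f x * g x)"
  by (intro bdd_bsupp_mult log_potential_measurable log_potential_bounded assms)

lemma log_potential_cmult: "log_potential e (\<lambda>y. c * f y) x = c * log_potential e f x"
  unfolding log_potential_def by (simp add: mult.left_commute)

definition log_energy :: "real \<Rightarrow> (real^2 \<Rightarrow> real) \<Rightarrow> (real^2 \<Rightarrow> real) \<Rightarrow> real" where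
  "log_energy e f g = (\<integral>x. log_potential e f x * g x \<partial>lborel)"

lemma log_energy_add_right:
  assumes "0 < e" "bdd_bsupp f" "bdd_bsupp g1" "bdd_bsupp g2"
  shows "log_energy e f (\<lambda>x. g1 x + g2 x) = log_energy e f g1 + log_energy e f g2"
  unfolding log_energy_def using assms
  by (simp add: distrib_left bdd_bsupp_integrable bdd_bsupp_potential_mult)

lemma log_energy_cmult_right: "log_energy e f (\<lambda>x. c * g x) = c * log_energy e f g"
  unfolding log_energy_def by (simp add: mult.left_commute)

text \<open>Symmetry of the kernel and Fubini. Integrability on the product is supplied by the
  dominating function \<open>?dom\<close>, whose integral in \<open>y\<close> is at most C |g x|
  with C independent of \<open>x\<close>.\<close>

lemma log_energy_commute:
  assumes "0 < e" "bdd_bsupp f" "bdd_bsupp g"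
  shows "log_energy e f g = log_energy e g f"
proof -
  have [measurable]: "f \<in> borel_measurable borel" "g \<in> borel_measurable borel"
    using assms by (auto dest: bdd_bsupp_measurable)
  obtain M r where M: "0 < M" "0 < r" "\<And>x. \<bar>f x\<bar> \<le> M * indicator (cball 0 r) x"
    by (rule bdd_bsuppE[OF assms(2)]) blast
  obtain N s where N: "0 < N" "0 < s" "\<And>x. \<bar>g x\<bar> \<le> N * indicator (cball 0 s) x"
    by (rule bdd_bsuppE[OF assms(3)]) blast
  let ?k = "\<lambda>x y. log_kernel e x y * f y * g x"
  let ?dom = "\<lambda>x y. \<bar>g x\<bar> * (M * log_pole e x y + M * ((s + r) / e) * indicator (cball 0 r) y)"
  have dom_int: "integrable lborel (?dom x)" for x
    by (intro Bochner_Integration.integrable_add integrable_mult_right integrable_log_pole assms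
          integrable_real_indicator) (auto simp: emeasure_cball_less_top)
  have k_int: "integrable lborel (?k x)" for x
    by (intro integrable_mult_left integrable_log_kernel_mult assms)
  have le: "norm (?k x y) \<le> ?dom x y" for x y
  proof (cases "x \<in> cball 0 s")
    case True
    then have "\<bar>log_kernel e x y * f y\<bar> \<le> M * log_pole e x y + M * ((s + r) / e) * indicator (cball 0 r) y"
      using N(2) by (intro abs_log_kernel_mult_le assms M) auto
    from mult_left_mono[OF this abs_ge_zero[of "g x"]] show ?thesis
      by (simp add: abs_mult mult_ac)
  next
    case False
    then show ?thesis using N(3)[of x] by simp
  qed
  define C where "C = M * (2 * (pi * e\<^sup>2)) + M * ((s + r) / e) * measure lborel (cball (0 :: real^2) r)"
  have outer_le: "norm (\<integral>y. norm (?k x y) \<partial>lborel) \<le> norm (C * \<bar>g x\<bar>)" for x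
  proof -
    have "norm (\<integral>y. norm (?k x y) \<partial>lborel) = (\<integral>y. norm (?k x y) \<partial>lborel)"
      by simp
    also have "\<dots> \<le> (\<integral>y. ?dom x y \<partial>lborel)"
      by (intro integral_mono integrable_norm k_int dom_int le)
    also have "\<dots> = \<bar>g x\<bar> * (M * (\<integral>y. log_pole e x y \<partial>lborel)
        + M * ((s + r) / e) * measure lborel (cball (0 :: real^2) r))"
      using assms(1) by (simp, subst Bochner_Integration.integral_add) 
        (auto simp: integrable_log_pole emeasure_cball_less_top intro!: integrable_real_indicator)
    also have "\<dots> \<le> \<bar>g x\<bar> * C"
      unfolding C_def using integrable_log_pole(2)[OF assms(1), of x] M(1) by (intro mult_left_mono) auto
    finally show ?thesis by (simp add: mult.commute)
  qed
  have "integrable (lborel \<Otimes>\<^sub>M lborel) (case_prod ?k)"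
  proof (rule lborel_pair.Fubini_integrable)
    have "(\<lambda>p. log_kernel e (fst p) (snd p) * f (snd p) * g (fst p)) \<in> borel_measurable (borel \<Otimes>\<^sub>M borel)"
      by measurable
    then show meas: "case_prod ?k \<in> borel_measurable (lborel \<Otimes>\<^sub>M lborel)"
      by (simp add: case_prod_beta')
    show "integrable lborel (\<lambda>x. \<integral>y. norm (case (x, y) of (x, y) \<Rightarrow> ?k x y) \<partial>lborel)"
    proof (rule Bochner_Integration.integrable_bound)
      show "integrable lborel (\<lambda>x. C * \<bar>g x\<bar>)"
        using assms(3) by (intro integrable_mult_right integrable_abs bdd_bsupp_integrable)
      show "(\<lambda>x. \<integral>y. norm (case (x, y) of (x, y) \<Rightarrow> ?k x y) \<partial>lborel) \<in> borel_measurable lborel"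
        using meas by (intro lborel.borel_measurable_lebesgue_integral) (simp add: case_prod_beta')
      show "AE x in lborel. norm (\<integral>y. norm (case (x, y) of (x, y) \<Rightarrow> ?k x y) \<partial>lborel) \<le> norm (C * \<bar>g x\<bar>)"
        using outer_le by simp
    qed
    show "AE x in lborel. integrable lborel (\<lambda>y. case (x, y) of (x, y) \<Rightarrow> ?k x y)"
      using k_int by simp
  qed
  from lborel_pair.Fubini_integral[OF this]
  show ?thesis
    unfolding log_energy_def log_potential_def
    by (simp add: log_kernel_commute mult.commute mult.left_commute flip: integral_mult_left_zero integral_mult_right_zero)
qed

lemma log_energy_add_left:
  assumes "0 < e" "bdd_bsupp f1" "bdd_bsupp f2" "bdd_bsupp g"
  shows "log_energy e (\<lambda>x. f1 x + f2 x) g = log_energy e f1 g + log_energy e f2 g"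
  using assms log_energy_add_right[of e g f1 f2] log_energy_commute[OF assms(1,4)]
    log_energy_commute[OF assms(1) bdd_bsupp_add[OF assms(2,3)] assms(4)]
  by simp

lemma log_energy_cmult_left: "log_energy e (\<lambda>x. c * f x) g = c * log_energy e f g"
  unfolding log_energy_def by (simp add: log_potential_cmult mult.assoc)

text \<open>Symmetry merges the two cross terms. The formula serves twice: for small t as a first
  variation, and for t equal to the sign of a vortex to split the energy of a pair.\<close>

lemma log_energy_perturb:
  assumes "0 < e" "bdd_bsupp f" "bdd_bsupp \<phi>"
  shows "log_energy e (\<lambda>x. f x + t * \<phi> x) (\<lambda>x. f x + t * \<phi> x)
    = log_energy e f f + 2 * t * log_energy e f \<phi> + t\<^sup>2 * log_energy e \<phi> \<phi>"
proof -
  have t: "bdd_bsupp (\<lambda>x. t * \<phi> x)" by (intro bdd_bsupp_cmult assms)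
  show ?thesis
    using log_energy_commute[OF assms]
    by (simp add: log_energy_add_left log_energy_add_right bdd_bsupp_add t assms
        log_energy_cmult_left log_energy_cmult_right power2_eq_square algebra_simps)
qed

text \<open>Off the diagonal the two kernels differ by the constant ln e. Densities of equal mass
  therefore have the same energy differences for every \<open>e\<close>.\<close>

lemma log_energy_scale:
  assumes "0 < e" "bdd_bsupp f"
  shows "log_energy e f f = log_energy 1 f f + ln e * (\<integral>x. f x \<partial>lborel)\<^sup>2"
proof -
  have pot: "log_potential e f x = log_potential 1 f x + ln e * (\<integral>y. f y \<partial>lborel)" for x
  proof -
    \<comment> \<open>On the diagonal both kernels are 0 and the identity would fail; the single
      point y = x is discarded.\<close>
    have "AE y in lborel. log_kernel e x y * f y = log_kernel 1 x y * f y + ln e * f y"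
      using AE_lborel_singleton[of x]
    proof eventually_elim
      case (elim y)
      then show ?case
        using assms(1) by (simp add: log_kernel_def ln_div algebra_simps)
    qed
    then have "log_potential e f x = (\<integral>y. log_kernel 1 x y * f y + ln e * f y \<partial>lborel)"
      unfolding log_potential_def using bdd_bsupp_measurable[OF assms(2)]
      by (intro integral_cong_AE) auto
    then show ?thesis
      unfolding log_potential_def
      by (simp add: integrable_log_kernel_mult assms bdd_bsupp_integrable)
  qed
  have "log_energy e f f = (\<integral>x. log_potential 1 f x * f x + (ln e * (\<integral>y. f y \<partial>lborel)) * f x \<partial>lborel)"
    unfolding log_energy_def pot by (simp add: algebra_simps)
  also have "\<dots> = log_energy 1 f f + (ln e * (\<integral>y. f y \<partial>lborel)) * (\<integral>y. f y \<partial>lborel)"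
    unfolding log_energy_def
    by (subst Bochner_Integration.integral_add)
      (auto simp: assms intro!: bdd_bsupp_integrable bdd_bsupp_potential_mult bdd_bsupp_cmult)
  finally show ?thesis by (simp add: power2_eq_square mult.assoc)
qed

section \<open>Concentration of a single vortex\<close>

text \<open>The sign is factored out and all constraints hold everywhere, not only almost
  everywhere, so that they can be used pointwise and competitors can be built by explicit
  formulas.\<close>

definition vortex_density :: "(real^2) set \<Rightarrow> real \<Rightarrow> real \<Rightarrow> (real^2 \<Rightarrow> real) \<Rightarrow> bool" where
  "vortex_density S lam m f \<longleftrightarrow> f \<in> borel_measurable borel \<and> (\<forall>x. 0 \<le> f x \<and> f x \<le> lam) \<and>
     (\<forall>x. x \<notin> S \<longrightarrow> f x = 0) \<and> (\<integral>x. f x \<partial>lborel) = m"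

lemma vortex_densityD:
  assumes "vortex_density S lam m f"
  shows "f \<in> borel_measurable borel" "0 \<le> f x" "f x \<le> lam" "x \<notin> S \<Longrightarrow> f x = 0"
    "(\<integral>x. f x \<partial>lborel) = m"
  using assms by (auto simp: vortex_density_def)

lemma vortex_density_bdd_bsupp:
  assumes "vortex_density S lam m f" "bounded S"
  shows "bdd_bsupp f"
  using vortex_densityD[OF assms(1)] assms(2)
  by (intro bdd_bsuppI[of f lam S]) auto

lemma bdd_bsupp_indicator:
  assumes "A \<in> sets borel" "bounded A"
  shows "bdd_bsupp (\<lambda>x. indicator A x)"
proof (rule bdd_bsuppI[OF _ _ _ assms(2)])
  show "(\<lambda>x. indicator A x :: real) \<in> borel_measurable borel"
    using assms(1) by (rule borel_measurable_indicator)
  show "\<bar>indicator A x :: real\<bar> \<le> 1" for x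
    by (simp add: indicator_def)
qed (rule indicator_simps(2))

lemma integral_log_pole_mult_le:
  assumes "0 < e" "f \<in> borel_measurable borel" "\<And>x. 0 \<le> f x" "\<And>x. f x \<le> lam"
  shows "integrable lborel (\<lambda>y. log_pole e x y * f y)"
    and "(\<integral>y. log_pole e x y * f y \<partial>lborel) \<le> 2 * (lam * pi * e\<^sup>2)"
proof -
  have int: "integrable lborel (\<lambda>y. log_pole e x y * lam)"
    by (intro integrable_mult_left integrable_log_pole assms)
  have le: "log_pole e x y * f y \<le> log_pole e x y * lam" for y
    by (intro mult_left_mono assms log_pole_nonneg)
  show int_f: "integrable lborel (\<lambda>y. log_pole e x y * f y)"
  proof (rule Bochner_Integration.integrable_bound[OF int])
    show "(\<lambda>y. log_pole e x y * f y) \<in> borel_measurable lborel"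
      using assms(2) by measurable
    have "\<bar>log_pole e x y * f y\<bar> \<le> \<bar>log_pole e x y * lam\<bar>" for y
      using le[of y] mult_nonneg_nonneg[OF log_pole_nonneg[of e x y] assms(3)[of y]] by linarith
    then show "AE y in lborel. norm (log_pole e x y * f y) \<le> norm (log_pole e x y * lam)"
      by simp
  qed
  have "0 \<le> lam"
    using assms(3,4) order_trans by blast
  have "(\<integral>y. log_pole e x y * f y \<partial>lborel) \<le> (\<integral>y. log_pole e x y * lam \<partial>lborel)"
    by (intro integral_mono int int_f le)
  also have "\<dots> \<le> 2 * (pi * e\<^sup>2) * lam"
    using integrable_log_pole(2)[OF assms(1), of x] \<open>0 \<le> lam\<close> by (simp add: mult_right_mono)
  finally show "(\<integral>y. log_pole e x y * f y \<partial>lborel) \<le> 2 * (lam * pi * e\<^sup>2)"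
    by (simp add: mult_ac)
qed

text \<open>Mass at distance at least R e meets a kernel value of at most - ln R, and the positive
  part of the kernel yields at most 2 lam pi e^2 in total. A lower bound on the potential thus
  limits the mass far from \<open>x\<close>.\<close>

lemma mass_outside_ball_le:
  assumes "0 < e" "1 \<le> R" "vortex_density S lam m f" "bounded S"
  shows "ln R * (\<integral>y. indicator (- ball x (R * e)) y * f y \<partial>lborel)
    \<le> 2 * (lam * pi * e\<^sup>2) - log_potential e f x"
proof -
  note f = vortex_densityD[OF assms(3)]
  have bf: "bdd_bsupp f"
    by (rule vortex_density_bdd_bsupp[OF assms(3,4)])
  have int_out: "integrable lborel (\<lambda>y. indicator (- ball x (R * e)) y * f y)"
    by (intro bdd_bsupp_integrable bdd_bsupp_mult bf) (auto intro!: exI[of _ 1] simp: indicator_def)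
  have le: "log_kernel e x y * f y \<le> log_pole e x y * f y - ln R * (indicator (- ball x (R * e)) y * f y)" for y
  proof (cases "y \<in> ball x (R * e)")
    case True
    then show ?thesis
      using mult_right_mono[OF log_kernel_le_pole f(2)] by simp
  next
    case False
    then have "R * e \<le> dist x y" by auto
    moreover have "0 < R * e" using assms by simp
    ultimately have d: "0 < dist x y" "ln (R * e) \<le> ln (dist x y)"
      by (auto simp del: zero_less_dist_iff intro!: ln_le_cancel_iff[THEN iffD2] elim: less_le_trans)
    have "log_kernel e x y = ln e - ln (dist x y)"
      using d(1) assms(1) unfolding log_kernel_def by (intro ln_divide_pos)
    also have "\<dots> \<le> - ln R"
      using d(2) assms(1,2) ln_mult_pos[of R e] by linarith
    finally have "log_kernel e x y \<le> - ln R" .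
    then have "log_kernel e x y \<le> log_pole e x y - ln R"
      using log_pole_nonneg[of e x y] by linarith
    from mult_right_mono[OF this f(2)[of y]] False show ?thesis
      by (simp add: algebra_simps)
  qed
  have "log_potential e f x
      \<le> (\<integral>y. log_pole e x y * f y - ln R * (indicator (- ball x (R * e)) y * f y) \<partial>lborel)"
    unfolding log_potential_def using f
    by (intro integral_mono le integrable_log_kernel_mult bf assms Bochner_Integration.integrable_diff
      integrable_mult_right int_out integral_log_pole_mult_le[of e f lam]) auto
  also have "\<dots> = (\<integral>y. log_pole e x y * f y \<partial>lborel) - ln R * (\<integral>y. indicator (- ball x (R * e)) y * f y \<partial>lborel)"
    using int_out integral_log_pole_mult_le(1)[OF assms(1) f(1-3)]
    by (subst Bochner_Integration.integral_diff) (auto intro: integrable_mult_right)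
  also have "\<dots> \<le> 2 * (lam * pi * e\<^sup>2) - ln R * (\<integral>y. indicator (- ball x (R * e)) y * f y \<partial>lborel)"
    using integral_log_pole_mult_le(2)[OF assms(1) f(1-3)] by simp
  finally show ?thesis by simp
qed

text \<open>With t = dist x y / e, the point \<open>y\<close> is within (t + 3) e of
  \<open>z\<close>. For t at most 1 one has ln (t + 3) at most ln 4 and the subtracted pole absorbs
  - ln t; for larger t one has t + 3 at most 4 t.\<close>

lemma log_kernel_near:
  assumes "0 < e" "dist z x \<le> 3 * e" "y \<noteq> z" "y \<noteq> x"
  shows "log_kernel e x y - ln 4 - log_pole e x y \<le> log_kernel e z y"
proof -
  define t where "t = dist x y / e"
  have t: "0 < t" "dist x y = t * e"
    using assms by (auto simp: t_def)
  have "dist z y \<le> (t + 3) * e"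
    using dist_triangle[of z y x] assms(2) t(2) by (simp add: algebra_simps)
  moreover have "0 < dist z y" using assms by simp
  ultimately have "ln (dist z y) \<le> ln ((t + 3) * e)"
    using less_le_trans by (intro ln_le_cancel_iff[THEN iffD2]) blast+
  also have "\<dots> = ln (t + 3) + ln e"
    using t assms(1) by (simp add: ln_mult)
  finally have z: "- ln (t + 3) \<le> log_kernel e z y"
    using assms \<open>0 < dist z y\<close> unfolding log_kernel_def by (simp add: ln_div)
  have x: "log_kernel e x y = - ln t"
    using assms t unfolding log_kernel_def by (simp add: ln_div ln_mult)
  then have pole: "log_pole e x y = max 0 (- ln t)"
    by (simp add: log_pole_def log_kernel_def)
  show ?thesis
  proof (cases "t \<le> 1")
    case True
    then have "ln (t + 3) \<le> ln 4" using t by simp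
    with z show ?thesis unfolding x pole by auto
  next
    case False
    then have "ln (t + 3) \<le> ln (4 * t)" using t by simp
    also have "\<dots> = ln 4 + ln t" using t by (subst ln_mult) auto
    finally show ?thesis using z unfolding x pole by auto
  qed
qed

text \<open>A Harnack-type estimate: a lower bound at one point spreads over distance 3 e at a cost
  of ln 4 per unit of mass, plus the contribution of the pole at \<open>x\<close>.\<close>

lemma log_potential_near:
  assumes "0 < e" "dist z x \<le> 3 * e" "vortex_density S lam m f" "bounded S"
  shows "log_potential e f x - ln 4 * m - 2 * (lam * pi * e\<^sup>2) \<le> log_potential e f z"
proof -
  note f = vortex_densityD[OF assms(3)]
  have bf: "bdd_bsupp f"
    by (rule vortex_density_bdd_bsupp[OF assms(3,4)])
  note int = integrable_log_kernel_mult[OF assms(1) bf] bdd_bsupp_integrable[OF bf]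
    integral_log_pole_mult_le(1)[OF assms(1) f(1-3)]
  have "AE y in lborel. log_kernel e x y * f y - ln 4 * f y - log_pole e x y * f y \<le> log_kernel e z y * f y"
    using AE_lborel_singleton[of x] AE_lborel_singleton[of z]
  proof eventually_elim
    case (elim y)
    from mult_right_mono[OF log_kernel_near[OF assms(1,2) elim(2,1)] f(2)[of y]]
    show ?case by (simp add: algebra_simps)
  qed
  then have "(\<integral>y. log_kernel e x y * f y - ln 4 * f y - log_pole e x y * f y \<partial>lborel) \<le> log_potential e f z"
    unfolding log_potential_def
    by (intro integral_mono_AE Bochner_Integration.integrable_diff integrable_mult_right int)
  also have "(\<integral>y. log_kernel e x y * f y - ln 4 * f y - log_pole e x y * f y \<partial>lborel)
     = log_potential e f x - ln 4 * m - (\<integral>y. log_pole e x y * f y \<partial>lborel)"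
    using int f(5) by (simp add: log_potential_def)
  finally show ?thesis
    using integral_log_pole_mult_le(2)[OF assms(1) f(1-3), of x] by linarith
qed

text \<open>Two points of a disc of radius \<open>e\<close> are less than 2 e apart, so the kernel
  is at least - ln 2 on it, uniformly in \<open>e\<close>.\<close>

lemma log_energy_disc_ge:
  assumes "0 < e" "0 < lam" "lam * pi * e\<^sup>2 = m"
  shows "vortex_density (ball a e) lam m (\<lambda>x. lam * indicator (ball a e) x)"
    and "- (ln 2 * m\<^sup>2) \<le> log_energy e (\<lambda>x. lam * indicator (ball a e) x) (\<lambda>x. lam * indicator (ball a e) x)"
proof -
  let ?d = "\<lambda>x. lam * indicator (ball a e) x :: real"
  have "measure lborel (ball a e) = pi * e\<^sup>2"
    using assms(1) by (simp add: measure_def emeasure_ball_plane)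
  then have int: "(\<integral>x. ?d x \<partial>lborel) = m"
    using assms by (simp add: mult_ac)
  show d: "vortex_density (ball a e) lam m ?d"
    unfolding vortex_density_def using assms int
    by (auto intro!: borel_measurable_times borel_measurable_indicator simp: indicator_def)
  have bd: "bdd_bsupp ?d"
    by (rule vortex_density_bdd_bsupp[OF d bounded_ball])
  have pot: "- (ln 2 * m) \<le> log_potential e ?d x" if "x \<in> ball a e" for x
  proof -
    have "AE y in lborel. - ln 2 * ?d y \<le> log_kernel e x y * ?d y"
      using AE_lborel_singleton[of x]
    proof eventually_elim
      case (elim y)
      show ?case
      proof (cases "y \<in> ball a e")
        case True
        with that have "dist x y \<le> 2 * e"
          using dist_triangle2[of x y a] by (simp add: dist_commute)
        moreover have "0 < dist x y" using elim by simp
        ultimately have "ln (dist x y) \<le> ln (2 * e)"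
          using assms(1) by (subst ln_le_cancel_iff) auto
        then have "- ln 2 \<le> log_kernel e x y"
          using \<open>0 < dist x y\<close> assms(1) unfolding log_kernel_def by (simp add: ln_div ln_mult)
        then show ?thesis
          using assms(2) by (intro mult_right_mono) auto
      qed simp
    qed
    then have "(\<integral>y. - ln 2 * ?d y \<partial>lborel) \<le> log_potential e ?d x"
      unfolding log_potential_def
      by (intro integral_mono_AE integrable_mult_right bdd_bsupp_integrable bd
          integrable_log_kernel_mult assms)
    also have "(\<integral>y. - ln 2 * ?d y \<partial>lborel) = - ln 2 * (\<integral>y. ?d y \<partial>lborel)"
      by (rule integral_mult_right_zero)
    finally show ?thesis
      unfolding int by simp
  qed
  have "- (ln 2 * m\<^sup>2) = - (ln 2 * m) * (\<integral>x. ?d x \<partial>lborel)"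
    unfolding int by (simp add: power2_eq_square)
  also have "\<dots> = (\<integral>x. - (ln 2 * m) * ?d x \<partial>lborel)"
    by (rule integral_mult_right_zero[symmetric])
  also have "\<dots> \<le> log_energy e ?d ?d"
    unfolding log_energy_def
  proof (intro integral_mono)
    show "integrable lborel (\<lambda>x. - (ln 2 * m) * ?d x)"
      by (intro integrable_mult_right bdd_bsupp_integrable bd)
    show "integrable lborel (\<lambda>x. log_potential e ?d x * ?d x)"
      by (intro bdd_bsupp_integrable bdd_bsupp_potential_mult bd assms)
    show "- (ln 2 * m) * ?d x \<le> log_potential e ?d x * ?d x" for x
      using mult_right_mono[OF pot[of x], of "?d x"] assms(2) by (cases "x \<in> ball a e") auto
  qed
  finally show "- (ln 2 * m\<^sup>2) \<le> log_energy e ?d ?d" .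
qed

text \<open>Shift \<open>x\<close> by \<rho> towards the centre \<open>a\<close>, or take
  \<open>a\<close> itself if it is nearer than that; a ball of radius \<rho> about the new point
  stays inside both balls.\<close>

lemma half_ball_subset:
  fixes x a :: "'a::euclidean_space"
  assumes "x \<in> ball a \<delta>" "0 \<le> \<rho>" "\<rho> \<le> \<delta>"
  obtains c where "ball c \<rho> \<subseteq> ball x (2 * \<rho>) \<inter> ball a \<delta>"
proof -
  have "\<exists>c. dist x c \<le> \<rho> \<and> dist a c \<le> \<delta> - \<rho>"
  proof (cases "dist x a \<le> \<rho>")
    case True
    then show ?thesis using assms by (intro exI[of _ a]) auto
  next
    case False
    define s where "s = \<rho> / dist x a"
    have s: "0 \<le> s" "s \<le> 1" "s * dist x a = \<rho>"
      using False assms by (auto simp: s_def divide_le_eq)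
    define c where "c = x + s *\<^sub>R (a - x)"
    have "dist x c = s * dist x a"
      using s by (simp add: c_def dist_norm norm_minus_commute)
    moreover have "a - c = (1 - s) *\<^sub>R (a - x)"
      by (simp add: c_def algebra_simps)
    then have "dist a c = (1 - s) * dist x a"
      using s by (simp add: dist_norm norm_minus_commute)
    ultimately show ?thesis
      using assms s by (intro exI[of _ c]) (auto simp: algebra_simps dist_commute)
  qed
  then obtain c where c: "dist x c \<le> \<rho>" "dist a c \<le> \<delta> - \<rho>" by blast
  have "dist x z < 2 * \<rho> \<and> dist a z < \<delta>" if "dist c z < \<rho>" for z
    using that c dist_triangle[of x z c] dist_triangle[of a z c] by linarith
  then show ?thesis
    by (intro that[of c]) auto
qed

section \<open>Variational argument for almost maximizers of the self-energy\<close>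

lemma le_of_small_perturbation:
  fixes a b c :: real
  assumes "0 < t0" "\<And>t. 0 < t \<Longrightarrow> t \<le> t0 \<Longrightarrow> a + t * b \<le> c"
  shows "a \<le> c"
proof (rule tendsto_upperbound)
  show "((\<lambda>t. a + t * b) \<longlongrightarrow> a) (at_right 0)"
    by (auto intro!: tendsto_eq_intros)
  show "\<forall>\<^sub>F t in at_right 0. a + t * b \<le> c"
    using assms by (auto simp: eventually_at_right_field intro!: exI[of _ t0])
qed simp

text \<open>The condition 3 e \<le> 2 \<delta> lets a disc of radius 3 e / 2 fit into
  \<open>ball a \<delta>\<close>, and hence also the comparison disc of radius
  \<open>e\<close>.\<close>

locale almost_maximizer =
  fixes a :: "real^2" and \<delta> lam m e C :: real and f :: "real^2 \<Rightarrow> real"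
  assumes e: "0 < e" "3 * e \<le> 2 * \<delta>" and lam: "0 < lam" and m: "lam * pi * e\<^sup>2 = m"
    and C: "0 \<le> C"
    and dens: "vortex_density (ball a \<delta>) lam m f"
    and max: "\<And>v. vortex_density (ball a \<delta>) lam m v \<Longrightarrow>
      log_energy e v v \<le> log_energy e f f + C * (\<integral>x. \<bar>v x - f x\<bar> \<partial>lborel)"
begin

lemma m_pos: "0 < m"
  using e lam m by (metis mult_pos_pos pi_gt_zero zero_less_power)

lemmas f = vortex_densityD[OF dens]

lemma bdd_f: "bdd_bsupp f"
  by (rule vortex_density_bdd_bsupp[OF dens bounded_ball])

lemma integral_abs_diff_le:
  assumes "vortex_density (ball a \<delta>) lam m v"
  shows "(\<integral>x. \<bar>v x - f x\<bar> \<partial>lborel) \<le> 2 * m"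
proof -
  note v = vortex_densityD[OF assms]
  have bv: "bdd_bsupp v"
    by (rule vortex_density_bdd_bsupp[OF assms bounded_ball])
  have "(\<integral>x. \<bar>v x - f x\<bar> \<partial>lborel) \<le> (\<integral>x. v x + f x \<partial>lborel)"
  proof (intro integral_mono bdd_bsupp_integrable bdd_bsupp_add bdd_bsupp_abs bdd_bsupp_diff bv bdd_f)
    show "\<bar>v x - f x\<bar> \<le> v x + f x" for x
      using v(2)[of x] f(2)[of x] by linarith
  qed
  also have "\<dots> = 2 * m"
    using bdd_bsupp_integrable[OF bv] bdd_bsupp_integrable[OF bdd_f] v(5) f(5) by simp
  finally show ?thesis .
qed

text \<open>The energy is the average of the potential against \<open>f\<close>. If the potential
  were below the stated level throughout, the energy would be at most - (ln 2 * m + 2 C + m) m,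
  whereas the disc forces at least - ln 2 * m^2 - 2 C m. The extra m in the level makes the
  contradiction strict.\<close>

lemma exists_high_potential:
  obtains x where "x \<in> ball a \<delta>" "- (ln 2 * m + 2 * C + m) \<le> log_potential e f x"
proof (rule ccontr)
  let ?A = "ln 2 * m + 2 * C + m"
  assume *: "\<not> thesis"
  let ?d = "\<lambda>x. lam * indicator (ball a e) x :: real"
  have d: "vortex_density (ball a \<delta>) lam m ?d"
    using log_energy_disc_ge(1)[OF e(1) lam m, of a] e by (auto simp: vortex_density_def)
  have "- (ln 2 * m\<^sup>2) \<le> log_energy e f f + C * (2 * m)"
    using log_energy_disc_ge(2)[OF e(1) lam m, of a] max[OF d]
      mult_left_mono[OF integral_abs_diff_le[OF d] C] by linarith
  moreover have "log_energy e f f \<le> (\<integral>x. - ?A * f x \<partial>lborel)"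
    unfolding log_energy_def
  proof (intro integral_mono bdd_bsupp_integrable bdd_bsupp_potential_mult bdd_f e bdd_bsupp_cmult)
    show "log_potential e f x * f x \<le> - ?A * f x" for x
    proof (cases "x \<in> ball a \<delta>")
      case True
      then have "log_potential e f x \<le> - ?A"
        using * that by fastforce
      then show ?thesis
        by (intro mult_right_mono f)
    qed (simp add: f(4))
  qed
  moreover have "(\<integral>x. - ?A * f x \<partial>lborel) = - ?A * m"
    unfolding f(5)[symmetric] by (rule integral_mult_right_zero)
  moreover have "0 < m * m" using m_pos by simp
  ultimately show False
    by (simp add: power2_eq_square algebra_simps)
qed

text \<open>Otherwise \<open>f\<close> would exceed lam / 2 almost everywhere on a disc of radius 3
  e / 2 and have mass at least (lam / 2) (9 / 4) pi e^2 = 9 m / 8.\<close>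

lemma exists_low_density:
  assumes "x \<in> ball a \<delta>"
  obtains Z where "Z \<in> sets borel" "Z \<subseteq> ball x (3 * e)" "Z \<subseteq> ball a \<delta>" "0 < measure lborel Z"
    "\<And>z. z \<in> Z \<Longrightarrow> f z \<le> lam / 2"
proof -
  obtain c where c: "ball c (3 / 2 * e) \<subseteq> ball x (3 * e) \<inter> ball a \<delta>"
    using half_ball_subset[OF assms, of "3 / 2 * e"] e by auto
  have [measurable]: "f \<in> borel_measurable borel" by (rule f)
  define Z where "Z = ball c (3 / 2 * e) \<inter> {z. f z \<le> lam / 2}"
  have Z: "Z \<in> sets borel" unfolding Z_def by measurable
  have "emeasure lborel Z \<noteq> 0"
  proof
    assume "emeasure lborel Z = 0"
    with Z have "Z \<in> null_sets lborel" by auto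
    then have "AE z in lborel. z \<notin> Z" by (rule AE_not_in)
    then have "AE z in lborel. lam / 2 * indicator (ball c (3 / 2 * e)) z \<le> f z"
      by eventually_elim (auto simp: Z_def indicator_def f(2))
    then have "(\<integral>z. lam / 2 * indicator (ball c (3 / 2 * e)) z \<partial>lborel) \<le> m"
      unfolding f(5)[symmetric] using e
      by (intro integral_mono_AE bdd_bsupp_integrable bdd_f integrable_mult_right integrable_real_indicator)
        (auto simp: emeasure_ball_plane)
    moreover have "measure lborel (ball c (3 / 2 * e)) = 9 / 4 * (pi * e\<^sup>2)"
      using e by (simp add: measure_def emeasure_ball_plane power2_eq_square)
    moreover have "(\<integral>z. lam / 2 * indicator (ball c (3 / 2 * e)) z \<partial>lborel)
        = lam / 2 * measure lborel (ball c (3 / 2 * e))"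
      by simp
    ultimately have "lam / 2 * (9 / 4 * (pi * e\<^sup>2)) \<le> m"
      by (simp only:)
    then have "9 / 8 * m \<le> m"
      unfolding m[symmetric] by (simp add: algebra_simps)
    with m_pos show False by simp
  qed
  moreover have "emeasure lborel Z < top"
  proof -
    have "emeasure lborel Z \<le> emeasure lborel (ball c (3 / 2 * e))"
      unfolding Z_def by (intro emeasure_mono) auto
    also have "\<dots> < top"
      using e by (simp add: emeasure_ball_plane)
    finally show ?thesis .
  qed
  ultimately have "0 < measure lborel Z"
    by (simp add: measure_def enn2real_positive_iff zero_less_iff_neq_zero)
  with Z c that[of Z] show ?thesis
    by (auto simp: Z_def)
qed

text \<open>The competitor is f + t \<phi>: it removes the fraction t of \<open>f\<close> on
  \<open>A\<close> and spreads that mass evenly over \<open>Z\<close>. It stays nonnegative for t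
  \<le> 1, and below \<open>lam\<close> because \<open>Z\<close> has room lam / 2. Almost
  maximality, divided by 2 t as t tends to 0, bounds the first variation by C \<alpha>.\<close>

lemma transfer_potential_le:
  assumes "Z \<in> sets borel" "Z \<subseteq> ball a \<delta>" "0 < measure lborel Z" "\<And>z. z \<in> Z \<Longrightarrow> f z \<le> lam / 2"
    and "A \<in> sets borel"
  defines "\<alpha> \<equiv> \<integral>x. indicator A x * f x \<partial>lborel"
  shows "\<alpha> / measure lborel Z * (\<integral>x. indicator Z x * log_potential e f x \<partial>lborel)
    - (\<integral>x. indicator A x * (log_potential e f x * f x) \<partial>lborel) \<le> C * \<alpha>"
proof -
  define c where "c = \<alpha> / measure lborel Z"
  define \<phi> where "\<phi> x = c * indicator Z x - indicator A x * f x" for x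
  have [measurable]: "f \<in> borel_measurable borel" "Z \<in> sets borel" "A \<in> sets borel"
    using assms f by auto
  have bA: "bdd_bsupp (\<lambda>x. indicator A x * f x)"
    by (rule bdd_bsupp_mult[OF bdd_f]) (auto intro!: exI[of _ 1] simp: indicator_def)
  have bZ: "bdd_bsupp (\<lambda>x. indicator Z x)"
    using assms(1) by (rule bdd_bsupp_indicator[OF _ bounded_subset[OF bounded_ball assms(2)]])
  have bcZ: "bdd_bsupp (\<lambda>x. c * indicator Z x)"
    by (intro bdd_bsupp_cmult bZ)
  have b\<phi>: "bdd_bsupp \<phi>"
    unfolding \<phi>_def by (intro bdd_bsupp_diff bcZ bA)
  have "0 \<le> \<alpha>"
    unfolding \<alpha>_def by (intro integral_nonneg_AE AE_I2) (simp add: f)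
  then have "0 \<le> c" unfolding c_def by simp
  have cZ: "(\<integral>x. c * indicator Z x \<partial>lborel) = \<alpha>"
    using assms(3) by (simp add: c_def)
  have \<phi>_mass: "(\<integral>x. \<phi> x \<partial>lborel) = 0"
    unfolding \<phi>_def
    by (subst Bochner_Integration.integral_diff[OF bdd_bsupp_integrable[OF bcZ] bdd_bsupp_integrable[OF bA]])
      (simp only: cZ \<alpha>_def[symmetric] diff_self)
  have \<phi>_abs: "(\<integral>x. \<bar>\<phi> x\<bar> \<partial>lborel) \<le> 2 * \<alpha>"
  proof -
    have "(\<integral>x. \<bar>\<phi> x\<bar> \<partial>lborel) \<le> (\<integral>x. c * indicator Z x + indicator A x * f x \<partial>lborel)"
    proof (intro integral_mono bdd_bsupp_integrable bdd_bsupp_abs b\<phi> bdd_bsupp_add bcZ bA)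
      have "0 \<le> c * indicator Z x" "0 \<le> indicator A x * f x" for x
        using \<open>0 \<le> c\<close> f(2)[of x] by auto
      then show "\<bar>\<phi> x\<bar> \<le> c * indicator Z x + indicator A x * f x" for x
        unfolding \<phi>_def by (smt (verit))
    qed
    also have "\<dots> = 2 * \<alpha>"
      by (subst Bochner_Integration.integral_add[OF bdd_bsupp_integrable[OF bcZ] bdd_bsupp_integrable[OF bA]])
        (simp only: cZ \<alpha>_def[symmetric] mult_2)
    finally show ?thesis .
  qed
  \<comment> \<open>This keeps t c \<le> lam / 2; the summand 1 avoids a zero denominator when c =
    0.\<close>
  define t0 where "t0 = min 1 (lam / (2 * (c + 1)))"
  have "0 < t0"
    using lam \<open>0 \<le> c\<close> by (simp add: t0_def)
  have le: "2 * log_energy e f \<phi> + t * log_energy e \<phi> \<phi> \<le> 2 * (C * \<alpha>)" if t: "0 < t" "t \<le> t0" for t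
  proof -
    let ?v = "\<lambda>x. f x + t * \<phi> x"
    have t1: "t \<le> 1" and "t \<le> lam / (2 * (c + 1))"
      using t by (auto simp: t0_def)
    then have "t * (2 * (c + 1)) \<le> lam"
      using \<open>0 \<le> c\<close> by (simp add: field_simps)
    then have tc: "t * c \<le> lam / 2"
      using t by (simp add: algebra_simps)
    have "vortex_density (ball a \<delta>) lam m ?v"
      unfolding vortex_density_def
    proof (intro conjI allI impI)
      show "?v \<in> borel_measurable borel"
        using b\<phi> by (auto dest: bdd_bsupp_measurable)
      fix x
      have tf: "t * f x \<le> f x" "0 \<le> t * f x"
        using t1 t f(2)[of x] by (auto intro: mult_left_le_one_le)
      have "0 \<le> t * c" using t \<open>0 \<le> c\<close> by simp
      show "0 \<le> ?v x"
        using tf \<open>0 \<le> t * c\<close> f(2)[of x] by (auto simp: \<phi>_def indicator_def algebra_simps)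
      show "?v x \<le> lam"
        using tf tc f(3)[of x] assms(4)[of x] by (auto simp: \<phi>_def indicator_def algebra_simps)
      show "?v x = 0" if "x \<notin> ball a \<delta>"
      proof -
        have "x \<notin> Z" using that assms(2) by auto
        then show ?thesis using that by (simp add: \<phi>_def f(4))
      qed
    next
      show "(\<integral>x. ?v x \<partial>lborel) = m"
        using \<phi>_mass bdd_bsupp_integrable[OF bdd_f] bdd_bsupp_integrable[OF b\<phi>] f(5) by simp
    qed
    from max[OF this] have "t * (2 * log_energy e f \<phi> + t * log_energy e \<phi> \<phi>) \<le> C * (t * (\<integral>x. \<bar>\<phi> x\<bar> \<partial>lborel))"
      using t by (simp add: log_energy_perturb e bdd_f b\<phi> abs_mult power2_eq_square algebra_simps)
    also have "\<dots> \<le> C * (t * (2 * \<alpha>))"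
      using C t by (intro mult_left_mono \<phi>_abs) auto
    finally have "t * (2 * log_energy e f \<phi> + t * log_energy e \<phi> \<phi>) \<le> t * (2 * (C * \<alpha>))"
      by (simp only: mult_ac)
    then show ?thesis
      using t(1) by (rule mult_left_le_imp_le)
  qed
  have "log_energy e f \<phi> \<le> C * \<alpha>"
    using le_of_small_perturbation[OF \<open>0 < t0\<close> le] by simp
  moreover have "log_energy e f \<phi> = (\<integral>x. c * (indicator Z x * log_potential e f x)
      - indicator A x * (log_potential e f x * f x) \<partial>lborel)"
    unfolding log_energy_def \<phi>_def by (intro Bochner_Integration.integral_cong) (auto simp: algebra_simps)
  also have "\<dots> = c * (\<integral>x. indicator Z x * log_potential e f x \<partial>lborel)
      - (\<integral>x. indicator A x * (log_potential e f x * f x) \<partial>lborel)"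
  proof (subst Bochner_Integration.integral_diff)
    show "integrable lborel (\<lambda>x. c * (indicator Z x * log_potential e f x))"
      using bdd_bsupp_integrable[OF bdd_bsupp_potential_mult[OF e(1) bdd_f bZ]]
      by (intro integrable_mult_right) (simp add: mult.commute)
    show "integrable lborel (\<lambda>x. indicator A x * (log_potential e f x * f x))"
      using bdd_bsupp_integrable[OF bdd_bsupp_potential_mult[OF e(1) bdd_f bA]]
      by (simp add: mult_ac)
  qed simp
  ultimately show ?thesis
    unfolding c_def by simp
qed

text \<open>The sum of all losses: (ln 2 + 1) m + 2 C at the high point, (ln 4 + 2) m for spreading
  to radius 3 e, C for the transfer of mass, and a further m for strictness.\<close>

definition potential_floor :: real where
  "potential_floor = (ln 2 + ln 4 + 4) * m + 3 * C"

text \<open>If the potential were below the floor on the whole ball, mass moved from there to the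
  low-density set near the high point would gain more than C per unit. The point found need not
  belong to the support; nearness to \<open>x\<close> is all that is used later.\<close>

lemma high_potential_dense:
  assumes "0 < r" "\<not> (AE z in lborel. z \<in> ball x r \<longrightarrow> f z = 0)"
  obtains y where "y \<in> ball x r" "- potential_floor \<le> log_potential e f y"
proof (rule ccontr)
  assume *: "\<not> thesis"
  \<comment> \<open>The level - A' is what \<open>log_potential_near\<close> guarantees on
    \<open>Z\<close>; the floor lies lower by C + m.\<close>
  define A' where "A' = (ln 2 + ln 4 + 3) * m + 2 * C"
  obtain x0 where x0: "x0 \<in> ball a \<delta>" "- (ln 2 * m + 2 * C + m) \<le> log_potential e f x0"
    by (rule exists_high_potential)
  obtain Z where Z: "Z \<in> sets borel" "Z \<subseteq> ball x0 (3 * e)" "Z \<subseteq> ball a \<delta>"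
    "0 < measure lborel Z" "\<And>z. z \<in> Z \<Longrightarrow> f z \<le> lam / 2"
    using exists_low_density[OF x0(1)] by blast
  have [measurable]: "f \<in> borel_measurable borel" "Z \<in> sets borel"
    using Z f by auto
  have bA: "bdd_bsupp (\<lambda>z. indicator (ball x r) z * f z)"
    by (rule bdd_bsupp_mult[OF bdd_f]) (auto intro!: exI[of _ 1] simp: indicator_def)
  have bZ: "bdd_bsupp (\<lambda>x. indicator Z x)"
    using Z(1) by (rule bdd_bsupp_indicator[OF _ bounded_subset[OF bounded_ball Z(3)]])
  define \<alpha> where "\<alpha> = (\<integral>z. indicator (ball x r) z * f z \<partial>lborel)"
  have "0 \<le> \<alpha>"
    unfolding \<alpha>_def by (intro integral_nonneg_AE AE_I2) (simp add: f)
  moreover have "\<alpha> \<noteq> 0"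
  proof
    assume "\<alpha> = 0"
    then have "AE z in lborel. indicator (ball x r) z * f z = 0"
      unfolding \<alpha>_def using bdd_bsupp_integrable[OF bA]
      by (subst (asm) integral_nonneg_eq_0_iff_AE) (auto simp: f)
    then have "AE z in lborel. z \<in> ball x r \<longrightarrow> f z = 0"
      by eventually_elim auto
    with assms(2) show False by simp
  qed
  ultimately have "0 < \<alpha>" by simp
  have "- A' * measure lborel Z = (\<integral>z. - A' * indicator Z z \<partial>lborel)"
    by simp
  also have "\<dots> \<le> (\<integral>z. indicator Z z * log_potential e f z \<partial>lborel)"
  proof (intro integral_mono)
    show "integrable lborel (\<lambda>z. - A' * indicator Z z)"
      by (intro bdd_bsupp_integrable bdd_bsupp_cmult bZ)
    show "integrable lborel (\<lambda>z. indicator Z z * log_potential e f z)"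
      using bdd_bsupp_integrable[OF bdd_bsupp_potential_mult[OF e(1) bdd_f bZ]] by (simp add: mult.commute)
    fix z
    show "- A' * indicator Z z \<le> indicator Z z * log_potential e f z"
    proof (cases "z \<in> Z")
      case True
      then have "dist z x0 \<le> 3 * e"
        using Z(2) by (force simp: dist_commute)
      from log_potential_near[OF e(1) this dens bounded_ball] x0(2) True show ?thesis
        unfolding A'_def m by (simp add: algebra_simps)
    qed simp
  qed
  finally have "\<alpha> / measure lborel Z * (- A' * measure lborel Z)
      \<le> \<alpha> / measure lborel Z * (\<integral>z. indicator Z z * log_potential e f z \<partial>lborel)"
    using \<open>0 < \<alpha>\<close> by (intro mult_left_mono) auto
  then have 1: "- A' * \<alpha> \<le> \<alpha> / measure lborel Z * (\<integral>z. indicator Z z * log_potential e f z \<partial>lborel)"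
    using Z(4) by (simp add: mult.commute)
  have "(\<integral>z. indicator (ball x r) z * (log_potential e f z * f z) \<partial>lborel)
      \<le> (\<integral>z. - potential_floor * (indicator (ball x r) z * f z) \<partial>lborel)"
  proof (intro integral_mono)
    show "integrable lborel (\<lambda>z. indicator (ball x r) z * (log_potential e f z * f z))"
      using bdd_bsupp_integrable[OF bdd_bsupp_potential_mult[OF e(1) bdd_f bA]] by (simp add: mult_ac)
    show "integrable lborel (\<lambda>z. - potential_floor * (indicator (ball x r) z * f z))"
      by (intro bdd_bsupp_integrable bdd_bsupp_cmult bA)
    fix z
    show "indicator (ball x r) z * (log_potential e f z * f z) \<le> - potential_floor * (indicator (ball x r) z * f z)"
    proof (cases "z \<in> ball x r")
      case True
      then have "log_potential e f z \<le> - potential_floor"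
        using * that by fastforce
      from mult_right_mono[OF this f(2)[of z]] True show ?thesis by simp
    qed simp
  qed
  also have "\<dots> = - potential_floor * \<alpha>"
    unfolding \<alpha>_def by (rule integral_mult_right_zero)
  finally have "potential_floor * \<alpha> - A' * \<alpha> \<le> C * \<alpha>"
    using 1 transfer_potential_le[OF Z(1,3,4,5), of "ball x r"] unfolding \<alpha>_def[symmetric] by simp
  then have "(potential_floor - A' - C) * \<alpha> \<le> 0"
    by (simp add: algebra_simps)
  moreover have "potential_floor - A' - C = m"
    by (simp add: potential_floor_def A'_def algebra_simps)
  ultimately show False
    using \<open>0 < \<alpha>\<close> m_pos by (simp add: mult_le_0_iff)
qed

text \<open>By the choice of R less than half of the mass lies outside the ball of radius R e about
  either point. If the two balls were disjoint, the two outsides would cover the plane and the total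
  mass would be below m.\<close>

lemma dist_high_potential_le:
  assumes "1 \<le> R" "2 * (2 * m + potential_floor) < ln R * m"
    and "- potential_floor \<le> log_potential e f x" "- potential_floor \<le> log_potential e f y"
  shows "dist x y \<le> 2 * R * e"
proof (rule ccontr)
  assume "\<not> ?thesis"
  then have disj: "ball x (R * e) \<inter> ball y (R * e) = {}"
    by (intro disjoint_ballI) auto
  have "0 < ln R * m"
  proof -
    have "0 \<le> potential_floor"
      using C m_pos unfolding potential_floor_def by (intro add_nonneg_nonneg) auto
    then have "0 \<le> 2 * (2 * m + potential_floor)" using m_pos by simp
    then show ?thesis using assms(2) by (rule order.strict_trans1)
  qed
  then have lnR: "0 < ln R"
    using m_pos by (simp add: zero_less_mult_iff)
  let ?o = "\<lambda>w z. indicator (- ball w (R * e)) z * f z"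
  have bo: "bdd_bsupp (?o w)" for w
    by (rule bdd_bsupp_mult[OF bdd_f]) (auto intro!: exI[of _ 1] simp: indicator_def)
  have out: "(\<integral>z. ?o w z \<partial>lborel) < m / 2" if "- potential_floor \<le> log_potential e f w" for w
  proof -
    have "ln R * (\<integral>z. ?o w z \<partial>lborel) \<le> 2 * m + potential_floor"
      using mass_outside_ball_le[OF e(1) assms(1) dens bounded_ball, of w] that unfolding m by linarith
    also have "\<dots> < ln R * (m / 2)"
      using assms(2) by simp
    finally show ?thesis using lnR by simp
  qed
  have "m \<le> (\<integral>z. ?o x z + ?o y z \<partial>lborel)"
    unfolding f(5)[symmetric]
  proof (intro integral_mono bdd_bsupp_integrable bdd_f bdd_bsupp_add bo)
    show "f z \<le> ?o x z + ?o y z" for z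
      using disj f(2)[of z] by (auto simp: indicator_def)
  qed
  also have "\<dots> = (\<integral>z. ?o x z \<partial>lborel) + (\<integral>z. ?o y z \<partial>lborel)"
    by (intro Bochner_Integration.integral_add bdd_bsupp_integrable bo)
  finally show False
    using out[OF assms(3)] out[OF assms(4)] by simp
qed

text \<open>Both points are approximated by points of high potential, and the approximation error is
  sent to 0.\<close>

theorem dist_support_le:
  assumes "1 \<le> R" "2 * (2 * m + potential_floor) < ln R * m"
    and "\<And>r. 0 < r \<Longrightarrow> \<not> (AE z in lborel. z \<in> ball x r \<longrightarrow> f z = 0)"
    and "\<And>r. 0 < r \<Longrightarrow> \<not> (AE z in lborel. z \<in> ball y r \<longrightarrow> f z = 0)"
  shows "dist x y \<le> 2 * R * e"
proof (rule field_le_epsilon)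
  fix r :: real assume "0 < r"
  then have r: "0 < r / 2" by simp
  obtain x' where x': "x' \<in> ball x (r / 2)" "- potential_floor \<le> log_potential e f x'"
    by (rule high_potential_dense[OF r assms(3)[OF r]])
  obtain y' where y': "y' \<in> ball y (r / 2)" "- potential_floor \<le> log_potential e f y'"
    by (rule high_potential_dense[OF r assms(4)[OF r]])
  have "dist x' y' \<le> 2 * R * e"
    by (rule dist_high_potential_le[OF assms(1,2) x'(2) y'(2)])
  moreover have "dist x y \<le> dist x x' + dist x' y' + dist y y'"
    using dist_triangle[of x y x'] dist_triangle[of x' y y'] by (simp add: dist_commute)
  ultimately show "dist x y \<le> 2 * R * e + r"
    using x'(1) y'(1) by simp
qed

end

section \<open>The regular part of the Green function\<close>

lemma partial_has_derivative_line:
  fixes f :: "'a::euclidean_space \<Rightarrow> real"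
  assumes "f differentiable (at (p + t *\<^sub>R b))"
  shows "((\<lambda>s. f (p + s *\<^sub>R b)) has_real_derivative partial b f (p + t *\<^sub>R b)) (at t)"
proof -
  have "(f has_derivative frechet_derivative f (at (p + t *\<^sub>R b))) (at (p + t *\<^sub>R b))"
    using assms frechet_derivative_works by blast
  moreover have "((\<lambda>s. p + s *\<^sub>R b) has_derivative (\<lambda>s. s *\<^sub>R b)) (at t)"
    by (auto intro!: derivative_eq_intros)
  ultimately have "((\<lambda>s. f (p + s *\<^sub>R b)) has_derivative
      (\<lambda>s. frechet_derivative f (at (p + t *\<^sub>R b)) (s *\<^sub>R b))) (at t)"
    by (rule has_derivative_compose[rotated])
  moreover have "linear (frechet_derivative f (at (p + t *\<^sub>R b)))"
    using assms by (rule linear_frechet_derivative)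
  ultimately show ?thesis
    by (simp add: has_field_derivative_def linear_scale partial_def mult.commute[of _ "frechet_derivative _ _ _"])
qed

text \<open>The first derivative vanishes at the maximum. A positive second derivative would make it
  positive just to the right of 0, and the mean value theorem would give larger values of
  \<open>g\<close>.\<close>

lemma second_derivative_nonpos_at_max:
  fixes g g' :: "real \<Rightarrow> real"
  assumes "0 < d"
    and g: "\<And>t. \<bar>t\<bar> < d \<Longrightarrow> (g has_real_derivative g' t) (at t)"
    and g': "(g' has_real_derivative l) (at 0)"
    and max: "\<And>t. \<bar>t\<bar> < d \<Longrightarrow> g t \<le> g 0"
  shows "l \<le> 0"
proof (rule ccontr)
  assume "\<not> l \<le> 0"
  then have "0 < l" by simp
  have "g' 0 = 0"
    using DERIV_local_max[OF g[of 0] assms(1)] max assms(1) by auto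
  obtain d' where d': "0 < d'" "\<And>h. 0 < h \<Longrightarrow> h < d' \<Longrightarrow> g' 0 < g' h"
    using DERIV_pos_inc_right[OF g' \<open>0 < l\<close>] by auto
  define s where "s = min d d' / 2"
  have s: "0 < s" "s < d" "s < d'"
    using assms(1) d'(1) by (auto simp: s_def)
  obtain z where z: "0 < z" "z < s" "g s - g 0 = (s - 0) * g' z"
    using MVT2[of 0 s g g'] s g by (metis abs_of_nonneg less_imp_le le_less_trans)
  have "0 < g' z"
    using d'(2)[of z] z s \<open>g' 0 = 0\<close> by simp
  then have "0 < g s - g 0"
    using z s by simp
  with max[of s] s show False by simp
qed

lemma harmonic_onD:
  assumes "harmonic_on S f" "x \<in> S" "b \<in> Basis"
  shows "f differentiable (at x)" "partial b f differentiable (at x)" "laplacian f x = 0"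
  using assms by (auto simp: harmonic_on_def numeral_2_eq_2)

lemma harmonic_on_zero: "harmonic_on S (\<lambda>_. 0)"
proof -
  have "partial b (\<lambda>_. 0) = (\<lambda>_. 0)" for b :: 'a
    by (auto simp: partial_def)
  then show ?thesis
    by (simp add: harmonic_on_def laplacian_def numeral_2_eq_2)
qed

text \<open>The added term has Laplacian 2 \<epsilon> times the dimension, which is positive, while
  at an interior maximum all pure second derivatives are nonpositive. Keeping \<open>u\<close> and
  \<open>v\<close> apart spares a proof that their difference is harmonic.\<close>

lemma harmonic_on_perturbed_no_max:
  fixes u v :: "'a::euclidean_space \<Rightarrow> real"
  assumes "open D" "p \<in> D" "harmonic_on D u" "harmonic_on D v" "0 < \<epsilon>"
  shows "\<exists>y\<in>D. u p - v p + \<epsilon> * (norm p)\<^sup>2 < u y - v y + \<epsilon> * (norm y)\<^sup>2"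
proof (rule ccontr)
  assume *: "\<not> ?thesis"
  obtain d where d: "0 < d" "ball p d \<subseteq> D"
    using assms(1,2) openE by blast
  have "partial b (partial b u) p - partial b (partial b v) p + 2 * \<epsilon> \<le> 0" if b: "b \<in> Basis" for b
  proof (rule second_derivative_nonpos_at_max[OF d(1)])
    let ?q = "\<lambda>t. p + t *\<^sub>R b"
    let ?g = "\<lambda>t. u (?q t) - v (?q t) + \<epsilon> * ((norm p)\<^sup>2 + 2 * t * (p \<bullet> b) + t\<^sup>2)"
    let ?g' = "\<lambda>t. partial b u (?q t) - partial b v (?q t) + \<epsilon> * (2 * (p \<bullet> b) + 2 * t)"
    have norm_b: "norm b = 1" using b by simp
    have q: "?q t \<in> D" if "\<bar>t\<bar> < d" for t
      using d(2) that norm_b by (auto simp: dist_norm)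
    have norm_q: "(norm (?q t))\<^sup>2 = (norm p)\<^sup>2 + 2 * t * (p \<bullet> b) + t\<^sup>2" for t
      unfolding power2_norm_eq_inner using b
      by (simp add: inner_simps inner_commute power2_eq_square algebra_simps)
    have du: "((\<lambda>t. u (?q t)) has_real_derivative partial b u (?q t)) (at t)"
      and dv: "((\<lambda>t. v (?q t)) has_real_derivative partial b v (?q t)) (at t)" if "\<bar>t\<bar> < d" for t
      using harmonic_onD(1)[OF assms(3) q[OF that] b] harmonic_onD(1)[OF assms(4) q[OF that] b]
      by (auto intro: partial_has_derivative_line)
    have quad: "((\<lambda>t. \<epsilon> * ((norm p)\<^sup>2 + 2 * t * (p \<bullet> b) + t\<^sup>2)) has_real_derivative
        \<epsilon> * (2 * (p \<bullet> b) + 2 * t)) (at t)" for t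
      by (auto intro!: derivative_eq_intros)
    show "(?g has_real_derivative ?g' t) (at t)" if "\<bar>t\<bar> < d" for t
      by (rule DERIV_add[OF DERIV_diff[OF du[OF that] dv[OF that]] quad])
    have ddu: "((\<lambda>t. partial b u (?q t)) has_real_derivative partial b (partial b u) p) (at 0)"
      and ddv: "((\<lambda>t. partial b v (?q t)) has_real_derivative partial b (partial b v) p) (at 0)"
      using partial_has_derivative_line[of "partial b u" p 0 b] harmonic_onD(2)[OF assms(3) assms(2) b]
        partial_has_derivative_line[of "partial b v" p 0 b] harmonic_onD(2)[OF assms(4) assms(2) b]
      by simp_all
    have lin: "((\<lambda>t. \<epsilon> * (2 * (p \<bullet> b) + 2 * t)) has_real_derivative 2 * \<epsilon>) (at 0)"
      by (auto intro!: derivative_eq_intros)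
    show "(?g' has_real_derivative partial b (partial b u) p - partial b (partial b v) p + 2 * \<epsilon>) (at 0)"
      by (rule DERIV_add[OF DERIV_diff[OF ddu ddv] lin])
    show "?g t \<le> ?g 0" if "\<bar>t\<bar> < d" for t
      using * q[OF that] norm_q[of t] by (force simp: not_less)
  qed
  then have "(\<Sum>b\<in>Basis. partial b (partial b u) p - partial b (partial b v) p + 2 * \<epsilon>) \<le> 0"
    by (rule sum_nonpos)
  moreover have "laplacian u p = 0" "laplacian v p = 0"
    using assms by (auto simp: harmonic_on_def)
  ultimately show False
    using assms(5) by (simp add: sum.distrib sum_subtractf laplacian_def mult_le_0_iff)
qed

text \<open>By the previous lemma the perturbed difference attains its maximum over the compact
  closure on the frontier; then \<epsilon> tends to 0.\<close>

lemma harmonic_on_diff_le_frontier: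
  fixes u v :: "'a::euclidean_space \<Rightarrow> real"
  assumes "open D" "bounded D" "harmonic_on D u" "harmonic_on D v"
    and cont: "continuous_on (closure D) u" "continuous_on (closure D) v"
    and le: "\<And>y. y \<in> frontier D \<Longrightarrow> u y - v y \<le> c"
    and y: "y \<in> closure D"
  shows "u y - v y \<le> c"
proof -
  obtain r where r: "\<And>z. z \<in> closure D \<Longrightarrow> norm z \<le> r"
    using assms(2) bounded_closure bounded_iff by metis
  have lim: "u y - v y - c \<le> \<epsilon> * r\<^sup>2" if "0 < \<epsilon>" for \<epsilon> :: real
  proof -
    let ?w = "\<lambda>z. u z - v z + \<epsilon> * (norm z)\<^sup>2"
    have "compact (closure D)" using assms(2) by simp
    moreover have "closure D \<noteq> {}" using y by auto
    moreover have "continuous_on (closure D) ?w"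
      by (intro continuous_intros cont)
    ultimately have "\<exists>p\<in>closure D. \<forall>z\<in>closure D. ?w z \<le> ?w p"
      by (rule continuous_attains_sup)
    then obtain p where p: "p \<in> closure D" "\<forall>z\<in>closure D. ?w z \<le> ?w p" ..
    have "p \<notin> D"
    proof
      assume "p \<in> D"
      from harmonic_on_perturbed_no_max[OF assms(1) this assms(3,4) \<open>0 < \<epsilon>\<close>]
      obtain z where "z \<in> D" "?w p < ?w z" ..
      moreover have "?w z \<le> ?w p"
        using p(2) \<open>z \<in> D\<close> closure_subset by blast
      ultimately show False by linarith
    qed
    then have "p \<in> frontier D"
      using p(1) assms(1) by (simp add: frontier_def interior_open)
    have "u y - v y \<le> ?w y" using that by simp
    also have "\<dots> \<le> ?w p" using p(2) y by (rule bspec)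
    also have "\<dots> \<le> c + \<epsilon> * r\<^sup>2"
      using le[OF \<open>p \<in> frontier D\<close>] r[OF p(1)] that
      by (intro add_mono mult_left_mono power_mono) auto
    finally show ?thesis by simp
  qed
  have "u y - v y - c \<le> 0"
  proof (rule tendsto_lowerbound)
    show "((\<lambda>\<epsilon>. \<epsilon> * r\<^sup>2) \<longlongrightarrow> 0) (at_right 0)"
      by (auto intro!: tendsto_eq_intros)
    show "\<forall>\<^sub>F \<epsilon> in at_right 0. u y - v y - c \<le> \<epsilon> * r\<^sup>2"
      using lim by (auto simp: eventually_at_right_field intro!: exI[of _ 1])
  qed simp
  then show ?thesis by simp
qed

lemma abs_ln_diff_le:
  fixes s t d :: real
  assumes "0 < d" "d \<le> s" "d \<le> t"
  shows "\<bar>ln s - ln t\<bar> \<le> \<bar>s - t\<bar> / d"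
proof -
  have *: "ln a - ln b \<le> \<bar>a - b\<bar> / d" if "d \<le> a" "d \<le> b" for a b
  proof -
    have "ln a - ln b = ln (a / b)"
      using that assms(1) by (intro ln_divide_pos[symmetric]) auto
    also have "\<dots> \<le> a / b - 1"
      using that assms(1) by (intro ln_le_minus_one) auto
    also have "\<dots> = (a - b) / b"
      using that assms(1) by (simp add: diff_divide_distrib)
    also have "\<dots> \<le> \<bar>a - b\<bar> / d"
      using that assms(1) by (intro frac_le) auto
    finally show ?thesis .
  qed
  show ?thesis
    using *[OF assms(2,3)] *[OF assms(3,2)] by (simp add: abs_le_iff abs_minus_commute)
qed

lemma abs_ln_le:
  fixes t d M :: real
  assumes "0 < d" "d \<le> t" "t \<le> M"
  shows "\<bar>ln t\<bar> \<le> M + 1 / d"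
proof -
  have t: "0 < t" using assms by linarith
  have "ln t \<le> M"
    using ln_le_minus_one[OF t] assms(3) by linarith
  moreover have "- ln t = ln (1 / t)"
    using t by (simp add: ln_divide_pos)
  moreover have "ln (1 / t) \<le> 1 / t - 1"
    using t by (intro ln_le_minus_one) auto
  moreover have "1 / t \<le> 1 / d"
    using assms by (intro frac_le) auto
  moreover have "0 < 1 / d" "0 < M" using assms by auto
  ultimately show ?thesis by linarith
qed

section \<open>Bounds and continuity of the regular part\<close>

context
  fixes D :: "(real^2) set" and G h :: "real^2 \<Rightarrow> real^2 \<Rightarrow> real"
  assumes D: "open D" "bounded D" and green: "green_function D G h"
begin

lemma green_regular_part_frontier:
  assumes "x \<in> D" "y \<in> frontier D"
  shows "h x y = - ln (dist x y) / (2 * pi)"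
proof -
  have "x \<noteq> y" "y \<in> closure D"
    using assms D by (auto simp: frontier_def interior_open)
  have "\<forall>y \<in> closure D - {x}. G x y = 1 / (2 * pi) * ln (1 / norm (x - y)) - h x y"
    "\<forall>y \<in> frontier D. G x y = 0"
    using green assms(1) unfolding green_function_def by blast+
  then have "G x y = 1 / (2 * pi) * ln (1 / norm (x - y)) - h x y" "G x y = 0"
    using \<open>x \<noteq> y\<close> \<open>y \<in> closure D\<close> assms(2) by blast+
  then have "h x y = 1 / (2 * pi) * ln (1 / norm (x - y))"
    by linarith
  also have "ln (1 / norm (x - y)) = - ln (dist x y)"
    using \<open>x \<noteq> y\<close> by (simp add: dist_norm ln_divide_pos)
  finally show ?thesis by simp
qed

lemma green_regular_part:
  assumes "x \<in> D"
  shows "harmonic_on D (h x)" "continuous_on (closure D) (h x)"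
  using green assms unfolding green_function_def by auto

text \<open>On the frontier \<open>h x\<close> is an explicit logarithm, bounded as long as the pole
  keeps away from the frontier. Comparison with the zero function in both directions carries the
  bound inside.\<close>

lemma abs_green_regular_part_le:
  assumes "x \<in> D" "y \<in> closure D" "0 < d"
    and "\<And>y. y \<in> frontier D \<Longrightarrow> d \<le> dist x y" "\<And>y. y \<in> frontier D \<Longrightarrow> dist x y \<le> M"
  shows "\<bar>h x y\<bar> \<le> (M + 1 / d) / (2 * pi)"
proof -
  have fr: "\<bar>h x z\<bar> \<le> (M + 1 / d) / (2 * pi)" if "z \<in> frontier D" for z
  proof -
    have "d \<le> dist x z" "dist x z \<le> M"
      using assms(4,5)[OF that] .
    then have "\<bar>ln (dist x z)\<bar> \<le> M + 1 / d"
      using assms(3) by (intro abs_ln_le)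
    then have "\<bar>ln (dist x z)\<bar> / (2 * pi) \<le> (M + 1 / d) / (2 * pi)"
      by (intro divide_right_mono) auto
    then show ?thesis
      unfolding green_regular_part_frontier[OF assms(1) that] by simp
  qed
  have "h x y - 0 \<le> (M + 1 / d) / (2 * pi)"
    using fr by (intro harmonic_on_diff_le_frontier[OF D green_regular_part(1) harmonic_on_zero
      green_regular_part(2) continuous_on_const _ assms(2)] assms(1)) (simp add: abs_le_iff)
  moreover have "0 - h x y \<le> (M + 1 / d) / (2 * pi)"
    using fr by (intro harmonic_on_diff_le_frontier[OF D harmonic_on_zero green_regular_part(1)
      continuous_on_const green_regular_part(2) _ assms(2)] assms(1)) (simp add: abs_le_iff)
  ultimately show ?thesis by (simp add: abs_le_iff)
qed

text \<open>\<open>green_function\<close> prescribes regularity only in the second argument. For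
  fixed poles \<open>h x\<close> and \<open>h x'\<close> are harmonic with logarithmic boundary
  values, and the logarithm is Lipschitz with constant 1 / d beyond distance d, so the maximum
  principle gives regularity in the pole.\<close>

lemma green_regular_part_lipschitz:
  assumes "x \<in> D" "x' \<in> D" "y \<in> closure D" "0 < d"
    and "\<And>y. y \<in> frontier D \<Longrightarrow> d \<le> dist x y" "\<And>y. y \<in> frontier D \<Longrightarrow> d \<le> dist x' y"
  shows "\<bar>h x y - h x' y\<bar> \<le> dist x x' / d"
proof -
  have fr: "h w z - h w' z \<le> dist x x' / d"
    if "z \<in> frontier D" "w = x \<and> w' = x' \<or> w = x' \<and> w' = x" for w w' z
  proof -
    have dz: "w \<in> D" "w' \<in> D" "d \<le> dist w z" "d \<le> dist w' z" "dist w w' = dist x x'"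
      using assms(1,2) assms(5,6)[OF that(1)] that(2) by (auto simp: dist_commute[of x' x])
    have "h w z - h w' z = (ln (dist w' z) - ln (dist w z)) / (2 * pi)"
      using green_regular_part_frontier[OF dz(1) that(1)] green_regular_part_frontier[OF dz(2) that(1)]
      by (simp add: field_simps)
    also have "\<dots> \<le> \<bar>ln (dist w' z) - ln (dist w z)\<bar> / (2 * pi)"
      by (intro divide_right_mono) auto
    also have "\<dots> \<le> \<bar>ln (dist w' z) - ln (dist w z)\<bar> / 1"
      using pi_gt3 by (intro divide_left_mono) auto
    also have "\<dots> \<le> \<bar>dist w' z - dist w z\<bar> / d"
      using abs_ln_diff_le[OF assms(4) dz(4,3)] by simp
    also have "\<dots> \<le> dist x x' / d"
      unfolding dz(5)[symmetric] using assms(4) abs_dist_diff_le[of w' z w]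
      by (intro divide_right_mono) (auto simp: dist_commute)
    finally show ?thesis .
  qed
  have "h x y - h x' y \<le> dist x x' / d" "h x' y - h x y \<le> dist x x' / d"
    using fr by (auto intro!: harmonic_on_diff_le_frontier[OF D green_regular_part(1) green_regular_part(1)
      green_regular_part(2) green_regular_part(2) _ assms(3)] assms)
  then show ?thesis by (simp add: abs_le_iff)
qed

lemma compact_frontier_dist:
  assumes "compact K" "K \<subseteq> D"
  shows "\<exists>d>0. \<exists>M\<ge>0. \<forall>x\<in>K. \<forall>y\<in>frontier D. d \<le> dist x y \<and> dist x y \<le> M"
proof -
  have "closed (frontier D)" "K \<inter> frontier D = {}"
    using assms D by (auto simp: frontier_def interior_open)
  then obtain d where d: "0 < d" "\<forall>x\<in>K. \<forall>y\<in>frontier D. d \<le> dist x y"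
    using separate_compact_closed[OF assms(1)] by blast
  have "bounded (K \<union> frontier D)"
    using assms(1) D(2) by (simp add: compact_imp_bounded frontier_def bounded_closure bounded_diff)
  then obtain M where M: "\<forall>x\<in>K \<union> frontier D. \<forall>y\<in>K \<union> frontier D. dist x y \<le> M"
    unfolding bounded_two_points by blast
  show ?thesis
    using d M by (intro exI[of _ d] exI[of _ "max M 0"] conjI) (auto simp: le_max_iff_disj)
qed

lemma green_regular_part_bounded:
  assumes "compact K" "K \<subseteq> D"
  obtains c where "0 \<le> c" "\<And>x y. x \<in> K \<Longrightarrow> y \<in> closure D \<Longrightarrow> \<bar>h x y\<bar> \<le> c"
proof -
  obtain d M where d: "0 < d" "0 \<le> M"
    and dM: "\<forall>x\<in>K. \<forall>y\<in>frontier D. d \<le> dist x y \<and> dist x y \<le> M"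
    using compact_frontier_dist[OF assms] by blast
  show ?thesis
  proof (rule that[of "(M + 1 / d) / (2 * pi)"])
    show "0 \<le> (M + 1 / d) / (2 * pi)"
      using d by (intro divide_nonneg_nonneg add_nonneg_nonneg) auto
    show "\<bar>h x y\<bar> \<le> (M + 1 / d) / (2 * pi)" if "x \<in> K" "y \<in> closure D" for x y
      using that assms(2) d dM by (intro abs_green_regular_part_le) auto
  qed
qed

text \<open>The Lipschitz bound in the pole is uniform in the second argument, so together with
  continuity of each \<open>h x\<close> it gives joint continuity. Its purpose is measurability of
  \<open>h\<close> on the product.\<close>

lemma green_regular_part_continuous:
  assumes "compact K" "K \<subseteq> D"
  shows "continuous_on (K \<times> closure D) (\<lambda>p. h (fst p) (snd p))"
  unfolding continuous_on_iff
proof (intro ballI allI impI)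
  obtain d M where d: "0 < d" "\<forall>x\<in>K. \<forall>y\<in>frontier D. d \<le> dist x y \<and> dist x y \<le> M"
    using compact_frontier_dist[OF assms] by blast
  fix p :: "(real^2) \<times> (real^2)" and \<epsilon> :: real
  assume "p \<in> K \<times> closure D" and \<epsilon>: "0 < \<epsilon>"
  then obtain x y where p: "p = (x, y)" "x \<in> K" "y \<in> closure D" by auto
  then have "continuous_on (closure D) (h x)"
    using green_regular_part assms by auto
  then obtain s where s: "0 < s" "\<And>y'. y' \<in> closure D \<Longrightarrow> dist y' y < s \<Longrightarrow> dist (h x y') (h x y) < \<epsilon> / 2"
    using p(3) \<epsilon> unfolding continuous_on_iff by (metis half_gt_zero)
  show "\<exists>s>0. \<forall>q\<in>K \<times> closure D. dist q p < s \<longrightarrow> dist (h (fst q) (snd q)) (h (fst p) (snd p)) < \<epsilon>"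
  proof (intro exI[of _ "min s (\<epsilon> / 2 * d)"] conjI ballI impI)
    show "0 < min s (\<epsilon> / 2 * d)" using s d \<epsilon> by simp
    fix q assume q: "q \<in> K \<times> closure D" and dist: "dist q p < min s (\<epsilon> / 2 * d)"
    obtain x' y' where q': "q = (x', y')" "x' \<in> K" "y' \<in> closure D" using q by auto
    have "dist x' x < \<epsilon> / 2 * d" "dist y' y < s"
      using dist dist_fst_le[of q p] dist_snd_le[of q p] unfolding p(1) q'(1) by auto
    then have "dist x' x / d < \<epsilon> / 2"
      using d(1) by (simp add: divide_less_eq)
    moreover have "\<bar>h x' y' - h x y'\<bar> \<le> dist x' x / d"
      using assms p(2) q' d by (intro green_regular_part_lipschitz) auto
    ultimately show "dist (h (fst q) (snd q)) (h (fst p) (snd p)) < \<epsilon>"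
      using s(2)[OF q'(3) \<open>dist y' y < s\<close>] unfolding p(1) q'(1) fst_conv snd_conv dist_real_def by linarith
  qed
qed

end

section \<open>Kinetic energy of two vortices\<close>

lemma lint_lebesgue_on_eq_lborel:
  fixes F F' :: "real^2 \<Rightarrow> real"
  assumes "D \<in> sets borel" "F \<in> borel_measurable borel" "\<And>x. x \<notin> D \<Longrightarrow> F x = 0"
    and "AE x in lborel. x \<in> D \<longrightarrow> F' x = F x"
  shows "(LINT x|lebesgue_on D. F' x) = (\<integral>x. F x \<partial>lborel)"
proof -
  have D: "D \<in> sets lebesgue" using assms(1) by auto
  have ae: "AE x in lebesgue. F x = (if x \<in> D then F' x else 0)"
    unfolding AE_completion_iff using assms(4) by eventually_elim (auto simp: assms(3))
  have F: "F \<in> borel_measurable lebesgue"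
    using assms(2) by (intro measurable_completion) auto
  have "(LINT x|lebesgue_on D. F' x) = (\<integral>x. (if x \<in> D then F' x else 0) \<partial>lebesgue)"
    by (rule Lebesgue_Measure.integral_restrict_UNIV[OF D, symmetric])
  also have "\<dots> = (\<integral>x. F x \<partial>lebesgue)"
    \<comment> \<open>\<open>F'\<close> is not assumed measurable; Lebesgue measure is complete, so
      almost everywhere agreement with \<open>F\<close> suffices.\<close>
    by (rule integral_cong_AE[OF borel_measurable_AE[OF F ae] F]) (use ae in eventually_elim, auto)
  also have "\<dots> = (\<integral>x. F x \<partial>lborel)"
    using assms(2) by (intro integral_completion) auto
  finally show ?thesis .
qed

lemma AE_lebesgue_on_iff_lborel:
  assumes "D \<in> sets borel"
  shows "(AE x in lebesgue_on D. P x) \<longleftrightarrow> (AE x in lborel. x \<in> D \<longrightarrow> P x)"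
  using assms by (subst AE_restrict_space_iff) (auto simp: AE_completion_iff)

lemma signed_vorticity_obtain_density:
  assumes w: "w \<in> signed_vorticities D B \<kappa> lam" and "D \<in> sets borel" "B \<in> sets borel" "B \<subseteq> D"
    and "\<kappa> \<noteq> 0" "0 \<le> lam"
  obtains f where "vortex_density B lam \<bar>\<kappa>\<bar> f" "AE x in lebesgue_on D. w x = sgn \<kappa> * f x"
proof -
  have D: "D \<in> sets lebesgue" using assms(2) by auto
  have "(\<lambda>x. if x \<in> D then w x else 0) \<in> borel_measurable lebesgue"
    using w D by (auto simp: signed_vorticities_def L_infinity_def borel_measurable_if)
  then obtain w' where w': "w' \<in> borel_measurable lborel" "AE x in lborel. (if x \<in> D then w x else 0) = w' x"
    using completion_ex_borel_measurable_real by blast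
  have sgn_sq: "sgn \<kappa> * (sgn \<kappa> * t) = t" for t
    using assms(5) by (simp add: sgn_if)
  \<comment> \<open>A Borel representative, set to 0 wherever a constraint fails; this changes it on
    a null set only and makes the constraints hold everywhere.\<close>
  define f where "f x = (if x \<in> B \<and> 0 \<le> sgn \<kappa> * w' x \<and> sgn \<kappa> * w' x \<le> lam then sgn \<kappa> * w' x else 0)" for x
  have [measurable]: "B \<in> sets borel" "w' \<in> borel_measurable borel"
    using assms(3) w'(1) by auto
  have f_meas: "f \<in> borel_measurable borel"
    unfolding f_def[abs_def] by measurable
  have "AE x in lborel. x \<in> D \<longrightarrow> 0 \<le> sgn \<kappa> * w x \<and> sgn \<kappa> * w x \<le> lam"
    "AE x in lborel. x \<in> D \<longrightarrow> x \<notin> B \<longrightarrow> w x = 0"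
    using w assms(2) by (auto simp: signed_vorticities_def AE_lebesgue_on_iff_lborel)
  with w'(2) have ae: "AE x in lborel. x \<in> D \<longrightarrow> sgn \<kappa> * w x = f x"
    by eventually_elim (auto simp: f_def)
  have "(\<integral>x. f x \<partial>lborel) = (LINT x|lebesgue_on D. sgn \<kappa> * w x)"
    using assms(4) by (intro lint_lebesgue_on_eq_lborel[symmetric] assms(2) f_meas ae) (auto simp: f_def)
  also have "\<dots> = sgn \<kappa> * \<kappa>"
    using w by (simp add: signed_vorticities_def)
  also have "\<dots> = \<bar>\<kappa>\<bar>"
    by (simp add: abs_sgn mult.commute)
  finally have "vortex_density B lam \<bar>\<kappa>\<bar> f"
    using f_meas assms(6) by (auto simp: vortex_density_def f_def)
  moreover have "AE x in lebesgue_on D. w x = sgn \<kappa> * f x"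
    unfolding AE_lebesgue_on_iff_lborel[OF assms(2)] using ae
  proof eventually_elim
    case (elim x)
    then show ?case using sgn_sq[of "w x"] by metis
  qed
  ultimately show ?thesis by (rule that)
qed

lemma vortex_density_signed_vorticity:
  assumes f: "vortex_density B lam \<bar>\<kappa>\<bar> f" and "D \<in> sets borel" "B \<subseteq> D" "\<kappa> \<noteq> 0"
  shows "(\<lambda>x. sgn \<kappa> * f x) \<in> signed_vorticities D B \<kappa> lam"
proof -
  note f' = vortex_densityD[OF f]
  have sgn_sq: "sgn \<kappa> * (sgn \<kappa> * t) = t" for t
    using assms(4) by (simp add: sgn_if)
  have "(\<lambda>x. sgn \<kappa> * f x) \<in> borel_measurable (lebesgue_on D)"
    using f'(1) by (intro measurable_restrict_space1 measurable_completion) auto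
  moreover have "\<bar>sgn \<kappa> * f x\<bar> \<le> lam" for x
    using f'(2,3)[of x] assms(4) by (simp add: abs_mult sgn_if)
  moreover have "(LINT x|lebesgue_on D. sgn \<kappa> * f x) = (\<integral>x. sgn \<kappa> * f x \<partial>lborel)"
    using f' assms(3) by (intro lint_lebesgue_on_eq_lborel assms(2)) auto
  moreover have "\<dots> = \<kappa>"
    using f'(5) by (simp add: sgn_mult_abs)
  ultimately show ?thesis
    using f' by (auto simp: signed_vorticities_def L_infinity_def sgn_sq intro!: exI[of _ lam])
qed

section \<open>Quadratic forms with a bounded kernel\<close>

definition bilinear_energy :: "(real^2 \<Rightarrow> real^2 \<Rightarrow> real) \<Rightarrow> (real^2 \<Rightarrow> real) \<Rightarrow> (real^2 \<Rightarrow> real) \<Rightarrow> real" where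
  "bilinear_energy H f g = (\<integral>x. (\<integral>y. H x y * f y \<partial>lborel) * g x \<partial>lborel)"

context
  fixes H :: "real^2 \<Rightarrow> real^2 \<Rightarrow> real" and c :: real
  assumes H_meas: "(\<lambda>p. H (fst p) (snd p)) \<in> borel_measurable (borel \<Otimes>\<^sub>M borel)"
    and H_bound: "\<And>x y. \<bar>H x y\<bar> \<le> c"
begin

lemma bdd_bsupp_bounded_kernel:
  assumes "bdd_bsupp f"
  shows "bdd_bsupp (\<lambda>y. H x y * f y)"
proof (rule bdd_bsupp_mult[OF assms])
  have "(\<lambda>y. (x, y)) \<in> borel \<rightarrow>\<^sub>M borel \<Otimes>\<^sub>M borel" by measurable
  from measurable_compose[OF this H_meas] show "H x \<in> borel_measurable borel" by simp
qed (use H_bound in blast)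

lemma bounded_kernel_potential_measurable:
  assumes "bdd_bsupp f"
  shows "(\<lambda>x. \<integral>y. H x y * f y \<partial>lborel) \<in> borel_measurable borel"
proof -
  note [measurable] = H_meas bdd_bsupp_measurable[OF assms]
  have "(\<lambda>x. \<integral>y. H (fst (x, y)) (snd (x, y)) * f y \<partial>lborel) \<in> borel_measurable borel"
    by (rule lborel.borel_measurable_lebesgue_integral) measurable
  then show ?thesis by simp
qed

lemma bounded_kernel_potential_le:
  assumes "bdd_bsupp f"
  shows "\<bar>\<integral>y. H x y * f y \<partial>lborel\<bar> \<le> c * (\<integral>y. \<bar>f y\<bar> \<partial>lborel)"
proof -
  have "\<bar>\<integral>y. H x y * f y \<partial>lborel\<bar> \<le> (\<integral>y. \<bar>H x y * f y\<bar> \<partial>lborel)"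
    by (rule integral_abs_bound)
  also have "\<dots> \<le> (\<integral>y. c * \<bar>f y\<bar> \<partial>lborel)"
    using assms
    by (intro integral_mono bdd_bsupp_integrable bdd_bsupp_abs bdd_bsupp_cmult bdd_bsupp_bounded_kernel)
      (auto simp: abs_mult intro: mult_right_mono H_bound)
  finally show ?thesis by simp
qed

lemma bdd_bsupp_bounded_kernel_potential:
  assumes "bdd_bsupp f" "bdd_bsupp g"
  shows "bdd_bsupp (\<lambda>x. (\<integral>y. H x y * f y \<partial>lborel) * g x)"
  using bounded_kernel_potential_le[OF assms(1)]
  by (intro bdd_bsupp_mult[OF assms(2)] bounded_kernel_potential_measurable assms(1)) blast

lemma bilinear_energy_le:
  assumes "bdd_bsupp f" "bdd_bsupp g"
  shows "\<bar>bilinear_energy H f g\<bar> \<le> c * (\<integral>y. \<bar>f y\<bar> \<partial>lborel) * (\<integral>x. \<bar>g x\<bar> \<partial>lborel)"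
proof -
  have "\<bar>bilinear_energy H f g\<bar> \<le> (\<integral>x. \<bar>(\<integral>y. H x y * f y \<partial>lborel) * g x\<bar> \<partial>lborel)"
    unfolding bilinear_energy_def by (rule integral_abs_bound)
  also have "\<dots> \<le> (\<integral>x. (c * (\<integral>y. \<bar>f y\<bar> \<partial>lborel)) * \<bar>g x\<bar> \<partial>lborel)"
    using assms
    by (intro integral_mono bdd_bsupp_integrable bdd_bsupp_abs bdd_bsupp_cmult bdd_bsupp_bounded_kernel_potential)
      (auto simp: abs_mult intro!: mult_right_mono bounded_kernel_potential_le)
  also have "\<dots> = c * (\<integral>y. \<bar>f y\<bar> \<partial>lborel) * (\<integral>x. \<bar>g x\<bar> \<partial>lborel)"
    by (rule integral_mult_right_zero)
  finally show ?thesis .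
qed

text \<open>The splitting H(f, f) - H(g, g) = H(f, f - g) + H(f - g, g) works for kernels that are
  not symmetric, such as \<open>h\<close> as it is specified here.\<close>

lemma bilinear_energy_diff_le:
  assumes "bdd_bsupp f" "bdd_bsupp g"
  shows "\<bar>bilinear_energy H f f - bilinear_energy H g g\<bar>
    \<le> c * ((\<integral>y. \<bar>f y\<bar> \<partial>lborel) + (\<integral>y. \<bar>g y\<bar> \<partial>lborel)) * (\<integral>y. \<bar>f y - g y\<bar> \<partial>lborel)"
proof -
  let ?d = "\<lambda>x. f x - g x"
  have bd: "bdd_bsupp ?d"
    by (intro bdd_bsupp_diff assms)
  have pot: "(\<integral>y. H x y * ?d y \<partial>lborel) = (\<integral>y. H x y * f y \<partial>lborel) - (\<integral>y. H x y * g y \<partial>lborel)" for x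
    using assms by (simp add: right_diff_distrib bdd_bsupp_integrable bdd_bsupp_bounded_kernel)
  note int = bdd_bsupp_integrable[OF bdd_bsupp_bounded_kernel_potential]
  have "bilinear_energy H f f - bilinear_energy H g g
      = (\<integral>x. (\<integral>y. H x y * f y \<partial>lborel) * ?d x + (\<integral>y. H x y * ?d y \<partial>lborel) * g x \<partial>lborel)"
    unfolding bilinear_energy_def pot
      Bochner_Integration.integral_diff[OF int[OF assms(1) assms(1)] int[OF assms(2) assms(2)], symmetric]
    by (simp add: algebra_simps)
  also have "\<dots> = bilinear_energy H f ?d + bilinear_energy H ?d g"
    unfolding bilinear_energy_def
    by (intro Bochner_Integration.integral_add int assms bd)
  finally show ?thesis
    using bilinear_energy_le[OF assms(1) bd] bilinear_energy_le[OF bd assms(2)]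
      abs_triangle_ineq[of "bilinear_energy H f ?d" "bilinear_energy H ?d g"]
    by (simp add: algebra_simps)
qed

end

text \<open>The cut-off to the two closed vortex discs turns \<open>h\<close> into a kernel that is
  bounded and Borel on the whole plane and agrees with \<open>h\<close> wherever the densities
  live.\<close>

definition cut_kernel :: "(real^2) set \<Rightarrow> (real^2 \<Rightarrow> real^2 \<Rightarrow> real) \<Rightarrow> real^2 \<Rightarrow> real^2 \<Rightarrow> real" where
  "cut_kernel K h x y = indicator (K \<times> K) (x, y) * h x y"

lemma cut_kernel_measurable:
  assumes "compact K" "continuous_on (K \<times> K) (\<lambda>p. h (fst p) (snd p))"
  shows "(\<lambda>p. cut_kernel K h (fst p) (snd p)) \<in> borel_measurable (borel \<Otimes>\<^sub>M borel)"
proof -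
  have "K \<times> K \<in> sets borel"
    using assms(1) by (intro borel_compact compact_Times)
  from borel_measurable_continuous_on_indicator[OF this assms(2)]
  show ?thesis
    by (simp add: cut_kernel_def borel_prod)
qed

lemma cut_kernel_bound:
  assumes "0 \<le> c" "\<And>x y. x \<in> K \<Longrightarrow> y \<in> K \<Longrightarrow> \<bar>h x y\<bar> \<le> c"
  shows "\<bar>cut_kernel K h x y\<bar> \<le> c"
  using assms by (auto simp: cut_kernel_def indicator_def)

text \<open>The factor 4 pi cancels the 1 / 2 of the kinetic energy and the 1 / (2 pi) of the Green
  function, so that the self-energy appears with coefficient 1.\<close>

lemma kinetic_energy_eq:
  assumes D: "open D" "compact K" "K \<subseteq> D" and green: "green_function D G h"
    and H: "(\<lambda>p. cut_kernel K h (fst p) (snd p)) \<in> borel_measurable (borel \<Otimes>\<^sub>M borel)"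
      "\<And>x y. \<bar>cut_kernel K h x y\<bar> \<le> c"
    and f: "bdd_bsupp f" "\<And>x. x \<notin> K \<Longrightarrow> f x = 0"
    and w: "AE x in lebesgue_on D. w x = f x"
  shows "4 * pi * kinetic_energy D G w = log_energy 1 f f - 2 * pi * bilinear_energy (cut_kernel K h) f f"
proof -
  let ?H = "cut_kernel K h"
  let ?U = "\<lambda>x. \<integral>y. ?H x y * f y \<partial>lborel"
  have D_borel: "D \<in> sets borel" using D(1) by auto
  have w': "AE x in lborel. x \<in> D \<longrightarrow> w x = f x"
    using w unfolding AE_lebesgue_on_iff_lborel[OF D_borel] .
  have f_meas: "f \<in> borel_measurable borel"
    by (rule bdd_bsupp_measurable[OF f(1)])
  have int_H: "integrable lborel (\<lambda>y. ?H x y * f y)" for x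
    by (intro bdd_bsupp_integrable bdd_bsupp_bounded_kernel[where c=c] H f)
  have int_k: "integrable lborel (\<lambda>y. log_kernel 1 x y * f y)" for x
    by (intro integrable_log_kernel_mult f) simp
  have inner: "(LINT y|lebesgue_on D. G x y * w x * w y) = (log_potential 1 f x / (2 * pi) - ?U x) * f x"
    if x: "x \<in> K" "w x = f x" for x
  proof -
    let ?F = "\<lambda>y. (log_kernel 1 x y * f y / (2 * pi) - ?H x y * f y) * f x"
    have "x \<in> D" using x D(3) by auto
    have G: "G x y = log_kernel 1 x y / (2 * pi) - h x y" if "y \<in> D" "y \<noteq> x" for y
    proof -
      have "y \<in> closure D - {x}" using that closure_subset by auto
      then show ?thesis
        using green \<open>x \<in> D\<close> unfolding green_function_def log_kernel_def dist_norm by auto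
    qed
    have "(LINT y|lebesgue_on D. G x y * w x * w y) = (\<integral>y. ?F y \<partial>lborel)"
    proof (rule lint_lebesgue_on_eq_lborel[OF D_borel])
      show "?F \<in> borel_measurable borel"
        using borel_measurable_integrable[OF int_k[of x]] borel_measurable_integrable[OF int_H[of x]]
        by (intro borel_measurable_times[OF borel_measurable_diff[OF borel_measurable_divide]]
          borel_measurable_const) (simp_all only: measurable_lborel2)
      show "?F y = 0" if "y \<notin> D" for y
      proof -
        have "f y = 0" using that D(3) by (intro f(2)) auto
        then show ?thesis by simp
      qed
      \<comment> \<open>The value \<open>G x x\<close> is unspecified, so the point y = x is left
        out.\<close>
      show "AE y in lborel. y \<in> D \<longrightarrow> G x y * w x * w y = ?F y"
        using w' AE_lborel_singleton[of x]
      proof eventually_elim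
        case (elim y)
        show ?case
        proof (cases "y \<in> K")
          case True
          then have "?H x y = h x y"
            using x by (simp add: cut_kernel_def)
          show ?thesis
          proof
            assume "y \<in> D"
            with elim have G_eq: "G x y = log_kernel 1 x y / (2 * pi) - h x y" and "w y = f y"
              using G by auto
            then show "G x y * w x * w y = ?F y"
              unfolding G_eq x(2) \<open>?H x y = h x y\<close> by (simp add: algebra_simps)
          qed
        next
          case False
          with elim f(2)[of y] show ?thesis by auto
        qed
      qed
    qed
    also have "\<dots> = (\<integral>y. log_kernel 1 x y * f y / (2 * pi) - ?H x y * f y \<partial>lborel) * f x"
      by (rule integral_mult_left_zero)
    also have "(\<integral>y. log_kernel 1 x y * f y / (2 * pi) - ?H x y * f y \<partial>lborel)
        = log_potential 1 f x / (2 * pi) - ?U x"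
      unfolding log_potential_def using int_H[of x] int_k[of x]
      by (subst Bochner_Integration.integral_diff) auto
    finally show ?thesis .
  qed
  have b1: "bdd_bsupp (\<lambda>x. log_potential 1 f x * f x)"
    by (intro bdd_bsupp_potential_mult f) simp
  have b2: "bdd_bsupp (\<lambda>x. ?U x * f x)"
    by (intro bdd_bsupp_bounded_kernel_potential[where c=c] H f)
  have "(LINT x|lebesgue_on D. LINT y|lebesgue_on D. G x y * w x * w y)
      = (\<integral>x. 1 / (2 * pi) * (log_potential 1 f x * f x) - ?U x * f x \<partial>lborel)"
  proof (rule lint_lebesgue_on_eq_lborel[OF D_borel])
    show "(\<lambda>x. 1 / (2 * pi) * (log_potential 1 f x * f x) - ?U x * f x) \<in> borel_measurable borel"
      by (intro bdd_bsupp_measurable bdd_bsupp_diff bdd_bsupp_cmult b1 b2)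
    show "1 / (2 * pi) * (log_potential 1 f x * f x) - ?U x * f x = 0" if "x \<notin> D" for x
    proof -
      have "f x = 0" using that D(3) by (intro f(2)) auto
      then show ?thesis by simp
    qed
    show "AE x in lborel. x \<in> D \<longrightarrow> (LINT y|lebesgue_on D. G x y * w x * w y)
        = 1 / (2 * pi) * (log_potential 1 f x * f x) - ?U x * f x"
      using w'
    proof eventually_elim
      case (elim x)
      show ?case
      proof (cases "x \<in> K")
        case True
        with elim D(3) have "w x = f x" by auto
        from inner[OF True this] show ?thesis
          by (simp add: left_diff_distrib)
      next
        case False
        with elim f(2)[of x] show ?thesis by simp
      qed
    qed
  qed
  also have "\<dots> = 1 / (2 * pi) * log_energy 1 f f - bilinear_energy ?H f f"
    unfolding log_energy_def bilinear_energy_def using bdd_bsupp_integrable[OF b1] bdd_bsupp_integrable[OF b2]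
    by (subst Bochner_Integration.integral_diff) auto
  finally show ?thesis
    by (simp add: kinetic_energy_def field_simps)
qed

text \<open>On \<open>A\<close> the potential of the distant vortex \<open>g\<close> is bounded by b
  m', so changing the other vortex alters the interaction by at most that much per unit of L1
  distance.\<close>

lemma log_energy_separated_diff_le:
  assumes v: "vortex_density A lam m v" and u: "vortex_density A lam m u" and g: "vortex_density B lam m' g"
    and bd: "bounded A" "bounded B"
    and b: "\<And>x y. x \<in> A \<Longrightarrow> y \<in> B \<Longrightarrow> \<bar>log_kernel 1 x y\<bar> \<le> b"
  shows "\<bar>log_energy 1 g v - log_energy 1 g u\<bar> \<le> b * m' * (\<integral>x. \<bar>v x - u x\<bar> \<partial>lborel)"
proof -
  have bv: "bdd_bsupp v" and bu: "bdd_bsupp u" and bg: "bdd_bsupp g"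
    using vortex_density_bdd_bsupp[OF v bd(1)] vortex_density_bdd_bsupp[OF u bd(1)]
      vortex_density_bdd_bsupp[OF g bd(2)] by auto
  let ?d = "\<lambda>x. v x - u x"
  have bdiff: "bdd_bsupp ?d" by (intro bdd_bsupp_diff bv bu)
  have one: "(0::real) < 1" by simp
  have pot: "\<bar>log_potential 1 g x\<bar> \<le> b * m'" if "x \<in> A" for x
  proof -
    have "\<bar>log_potential 1 g x\<bar> \<le> (\<integral>y. \<bar>log_kernel 1 x y * g y\<bar> \<partial>lborel)"
      unfolding log_potential_def by (rule integral_abs_bound)
    also have "\<dots> \<le> (\<integral>y. b * g y \<partial>lborel)"
    proof (intro integral_mono integrable_abs integrable_log_kernel_mult bdd_bsupp_integrable bdd_bsupp_cmult bg one)
      show "\<bar>log_kernel 1 x y * g y\<bar> \<le> b * g y" for y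
        using vortex_densityD[OF g] b[OF that, of y]
        by (cases "y \<in> B") (auto simp: abs_mult intro: mult_right_mono)
    qed
    also have "\<dots> = b * m'"
      using vortex_densityD(5)[OF g] by simp
    finally show ?thesis .
  qed
  have "log_energy 1 g v - log_energy 1 g u = (\<integral>x. log_potential 1 g x * ?d x \<partial>lborel)"
    unfolding log_energy_def right_diff_distrib
    by (intro Bochner_Integration.integral_diff[symmetric] bdd_bsupp_integrable bdd_bsupp_potential_mult one bg bv bu)
  also have "\<bar>\<dots>\<bar> \<le> (\<integral>x. \<bar>log_potential 1 g x * ?d x\<bar> \<partial>lborel)"
    by (rule integral_abs_bound)
  also have "\<dots> \<le> (\<integral>x. b * m' * \<bar>?d x\<bar> \<partial>lborel)"
  proof (intro integral_mono bdd_bsupp_integrable bdd_bsupp_abs bdd_bsupp_cmult bdd_bsupp_potential_mult one bg bdiff)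
    show "\<bar>log_potential 1 g x * ?d x\<bar> \<le> b * m' * \<bar>?d x\<bar>" for x
    proof (cases "x \<in> A")
      case True
      then show ?thesis
        unfolding abs_mult by (intro mult_right_mono pot) auto
    next
      case False
      then show ?thesis
        using vortex_densityD(4)[OF v] vortex_densityD(4)[OF u] by simp
    qed
  qed
  also have "\<dots> = b * m' * (\<integral>x. \<bar>?d x\<bar> \<partial>lborel)"
    by (rule integral_mult_right_zero)
  finally show ?thesis .
qed

lemma log_kernel_separated_bound:
  fixes A B :: "(real^2) set"
  assumes "compact A" "compact B" "A \<inter> B = {}"
  shows "\<exists>b\<ge>0. \<forall>x\<in>A. \<forall>y\<in>B. \<bar>log_kernel 1 x y\<bar> \<le> b"
proof -
  obtain d where d: "0 < d" "\<forall>x\<in>A. \<forall>y\<in>B. d \<le> dist x y"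
    using separate_compact_closed[OF assms(1) compact_imp_closed[OF assms(2)] assms(3)] by blast
  have "bounded (A \<union> B)"
    using assms by (simp add: compact_imp_bounded)
  then obtain M where M: "\<forall>x\<in>A \<union> B. \<forall>y\<in>A \<union> B. dist x y \<le> M"
    unfolding bounded_two_points by blast
  have "\<bar>log_kernel 1 x y\<bar> \<le> max M 0 + 1 / d" if "x \<in> A" "y \<in> B" for x y
  proof -
    have dxy: "d \<le> dist x y" "dist x y \<le> max M 0"
      using that d M by (auto simp: le_max_iff_disj)
    then have "0 < dist x y" using d(1) by linarith
    then have "log_kernel 1 x y = - ln (dist x y)"
      by (simp add: log_kernel_def ln_divide_pos)
    then show ?thesis
      using abs_ln_le[OF d(1) dxy] by simp
  qed
  moreover have "0 \<le> max M 0 + 1 / d"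
    using d(1) by simp
  ultimately show ?thesis by blast
qed

text \<open>The order of quantifiers is the point: C is fixed before \<open>lam\<close> and all
  densities.\<close>

lemma kinetic_energy_almost_maximizer:
  fixes a b :: "real^2"
  assumes D: "open D" "bounded D" and green: "green_function D G h"
    and balls: "cball a \<delta> \<subseteq> D" "cball b \<delta> \<subseteq> D" "cball a \<delta> \<inter> cball b \<delta> = {}"
    and \<kappa>: "\<kappa> \<noteq> 0" "\<kappa>' \<noteq> 0"
  shows "\<exists>C\<ge>0. \<forall>lam f g w.
    vortex_density (ball a \<delta>) lam \<bar>\<kappa>\<bar> f \<longrightarrow> vortex_density (ball b \<delta>) lam \<bar>\<kappa>'\<bar> g \<longrightarrow>
    (AE x in lebesgue_on D. w x = sgn \<kappa> * f x + sgn \<kappa>' * g x) \<longrightarrow>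
    (\<forall>v. vortex_density (ball a \<delta>) lam \<bar>\<kappa>\<bar> v \<longrightarrow>
      kinetic_energy D G (\<lambda>x. sgn \<kappa> * v x + sgn \<kappa>' * g x) \<le> kinetic_energy D G w) \<longrightarrow>
    (\<forall>v. vortex_density (ball a \<delta>) lam \<bar>\<kappa>\<bar> v \<longrightarrow>
      log_energy 1 v v \<le> log_energy 1 f f + C * (\<integral>x. \<bar>v x - f x\<bar> \<partial>lborel))"
proof -
  define K where "K = cball a \<delta> \<union> cball b \<delta>"
  have K: "compact K" "K \<subseteq> D"
    using balls by (auto simp: K_def intro: compact_Un)
  obtain c where c: "0 \<le> c" "\<And>x y. x \<in> K \<Longrightarrow> y \<in> closure D \<Longrightarrow> \<bar>h x y\<bar> \<le> c"
    using green_regular_part_bounded[OF D green K] by blast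
  have "K \<times> K \<subseteq> K \<times> closure D"
    using K(2) closure_subset by blast
  then have "continuous_on (K \<times> K) (\<lambda>p. h (fst p) (snd p))"
    by (rule continuous_on_subset[OF green_regular_part_continuous[OF D green K]])
  then have H_meas: "(\<lambda>p. cut_kernel K h (fst p) (snd p)) \<in> borel_measurable (borel \<Otimes>\<^sub>M borel)"
    by (rule cut_kernel_measurable[OF K(1)])
  have H_bound: "\<bar>cut_kernel K h x y\<bar> \<le> c" for x y
    using c K(2) closure_subset by (intro cut_kernel_bound) blast+
  obtain \<beta> where \<beta>: "0 \<le> \<beta>" "\<forall>x\<in>cball a \<delta>. \<forall>y\<in>cball b \<delta>. \<bar>log_kernel 1 x y\<bar> \<le> \<beta>"
    using log_kernel_separated_bound[OF compact_cball compact_cball balls(3)] by blast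
  \<comment> \<open>The first summand controls the logarithmic interaction of the two vortices, the
    second the contribution of \<open>h\<close>, where 2 pi c multiplies the sum of the masses of
    two competing pairs.\<close>
  define C where "C = 2 * (\<beta> * \<bar>\<kappa>'\<bar>) + 4 * pi * c * (\<bar>\<kappa>\<bar> + \<bar>\<kappa>'\<bar>)"
  have sgn: "\<bar>sgn \<kappa>\<bar> = 1" "\<bar>sgn \<kappa>'\<bar> = 1" "(sgn \<kappa>)\<^sup>2 = 1"
    using \<kappa> by (auto simp: sgn_if)
  have "log_energy 1 v v \<le> log_energy 1 f f + C * (\<integral>x. \<bar>v x - f x\<bar> \<partial>lborel)"
    if f: "vortex_density (ball a \<delta>) lam \<bar>\<kappa>\<bar> f" and g: "vortex_density (ball b \<delta>) lam \<bar>\<kappa>'\<bar> g"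
      and w: "AE x in lebesgue_on D. w x = sgn \<kappa> * f x + sgn \<kappa>' * g x"
      and v: "vortex_density (ball a \<delta>) lam \<bar>\<kappa>\<bar> v"
      and max: "kinetic_energy D G (\<lambda>x. sgn \<kappa> * v x + sgn \<kappa>' * g x) \<le> kinetic_energy D G w"
    for lam f g w v
  proof -
    let ?R = "bilinear_energy (cut_kernel K h)"
    let ?W = "\<lambda>u x. sgn \<kappa>' * g x + sgn \<kappa> * u x"
    define I where "I = (\<integral>x. \<bar>v x - f x\<bar> \<partial>lborel)"
    have bg: "bdd_bsupp (\<lambda>x. sgn \<kappa>' * g x)"
      by (rule bdd_bsupp_cmult[OF vortex_density_bdd_bsupp[OF g bounded_ball]])
    have bu: "bdd_bsupp u" and bW: "bdd_bsupp (?W u)" and mass: "(\<integral>x. \<bar>?W u x\<bar> \<partial>lborel) \<le> \<bar>\<kappa>\<bar> + \<bar>\<kappa>'\<bar>"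
      and outside: "\<And>x. x \<notin> K \<Longrightarrow> ?W u x = 0"
      and energy: "log_energy 1 (?W u) (?W u) = log_energy 1 (\<lambda>x. sgn \<kappa>' * g x) (\<lambda>x. sgn \<kappa>' * g x)
        + 2 * (sgn \<kappa> * sgn \<kappa>') * log_energy 1 g u + log_energy 1 u u"
      if u: "vortex_density (ball a \<delta>) lam \<bar>\<kappa>\<bar> u" for u
    proof -
      show bu: "bdd_bsupp u"
        by (rule vortex_density_bdd_bsupp[OF u bounded_ball])
      then show bW: "bdd_bsupp (?W u)"
        by (intro bdd_bsupp_add bg bdd_bsupp_cmult)
      note uD = vortex_densityD[OF u] and gD = vortex_densityD[OF g]
      have int: "integrable lborel u" "integrable lborel g"
        using bdd_bsupp_integrable[OF bu] bdd_bsupp_integrable[OF vortex_density_bdd_bsupp[OF g bounded_ball]] .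
      have "(\<integral>x. \<bar>?W u x\<bar> \<partial>lborel) \<le> (\<integral>x. u x + g x \<partial>lborel)"
      proof (intro integral_mono bdd_bsupp_integrable[OF bdd_bsupp_abs[OF bW]] Bochner_Integration.integrable_add int)
        show "\<bar>?W u x\<bar> \<le> u x + g x" for x
          using abs_triangle_ineq[of "sgn \<kappa>' * g x" "sgn \<kappa> * u x"] uD(2)[of x] gD(2)[of x]
          unfolding abs_mult sgn by simp
      qed
      also have "\<dots> = \<bar>\<kappa>\<bar> + \<bar>\<kappa>'\<bar>"
        using int uD(5) gD(5) by simp
      finally show "(\<integral>x. \<bar>?W u x\<bar> \<partial>lborel) \<le> \<bar>\<kappa>\<bar> + \<bar>\<kappa>'\<bar>" .
      show "?W u x = 0" if "x \<notin> K" for x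
        using that uD(4)[of x] gD(4)[of x] by (auto simp: K_def)
      show "log_energy 1 (?W u) (?W u) = log_energy 1 (\<lambda>x. sgn \<kappa>' * g x) (\<lambda>x. sgn \<kappa>' * g x)
          + 2 * (sgn \<kappa> * sgn \<kappa>') * log_energy 1 g u + log_energy 1 u u"
        using log_energy_perturb[OF zero_less_one bg bu, of "sgn \<kappa>"] sgn(3)
        by (simp only: log_energy_cmult_left mult_1 mult.assoc)
    qed
    have KE: "4 * pi * kinetic_energy D G w' = log_energy 1 (?W u) (?W u) - 2 * pi * ?R (?W u) (?W u)"
      if "vortex_density (ball a \<delta>) lam \<bar>\<kappa>\<bar> u" "AE x in lebesgue_on D. w' x = sgn \<kappa> * u x + sgn \<kappa>' * g x"
      for u w'
      using that
      by (intro kinetic_energy_eq[where c=c] D K green H_meas H_bound bW outside) (simp_all add: add.commute)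
    have "4 * pi * kinetic_energy D G (\<lambda>x. sgn \<kappa> * v x + sgn \<kappa>' * g x) \<le> 4 * pi * kinetic_energy D G w"
      using max by simp
    then have "log_energy 1 (?W v) (?W v) - 2 * pi * ?R (?W v) (?W v)
        \<le> log_energy 1 (?W f) (?W f) - 2 * pi * ?R (?W f) (?W f)"
      using KE[OF f w] KE[OF v AE_I2[OF refl]] by simp
    then have "log_energy 1 v v - log_energy 1 f f
        \<le> - (2 * (sgn \<kappa> * sgn \<kappa>') * (log_energy 1 g v - log_energy 1 g f))
          + 2 * pi * (?R (?W v) (?W v) - ?R (?W f) (?W f))"
      unfolding energy[OF v] energy[OF f] by (simp add: algebra_simps)
    also have "\<dots> \<le> 2 * (\<beta> * \<bar>\<kappa>'\<bar> * I) + 2 * pi * (2 * c * (\<bar>\<kappa>\<bar> + \<bar>\<kappa>'\<bar>) * I)"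
    proof (rule add_mono)
      have sep: "\<bar>log_energy 1 g v - log_energy 1 g f\<bar> \<le> \<beta> * \<bar>\<kappa>'\<bar> * I"
        unfolding I_def using \<beta>(2)
        by (intro log_energy_separated_diff_le[OF v f g bounded_ball bounded_ball]) auto
      have "- (2 * (sgn \<kappa> * sgn \<kappa>') * (log_energy 1 g v - log_energy 1 g f))
          \<le> \<bar>2 * (sgn \<kappa> * sgn \<kappa>') * (log_energy 1 g v - log_energy 1 g f)\<bar>"
        by (rule abs_ge_minus_self)
      also have "\<dots> = 2 * \<bar>log_energy 1 g v - log_energy 1 g f\<bar>"
        unfolding abs_mult sgn by simp
      also have "\<dots> \<le> 2 * (\<beta> * \<bar>\<kappa>'\<bar> * I)"
        using sep by (rule mult_left_mono) simp
      finally show "- (2 * (sgn \<kappa> * sgn \<kappa>') * (log_energy 1 g v - log_energy 1 g f))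
          \<le> 2 * (\<beta> * \<bar>\<kappa>'\<bar> * I)" .
      have diff: "(\<integral>x. \<bar>?W v x - ?W f x\<bar> \<partial>lborel) = I"
        unfolding I_def using sgn(1)
        by (intro Bochner_Integration.integral_cong) (auto simp: abs_mult simp flip: right_diff_distrib)
      have "?R (?W v) (?W v) - ?R (?W f) (?W f) \<le> c * ((\<integral>x. \<bar>?W v x\<bar> \<partial>lborel) + (\<integral>x. \<bar>?W f x\<bar> \<partial>lborel)) * I"
        using bilinear_energy_diff_le[OF H_meas H_bound bW[OF v] bW[OF f]] unfolding diff by linarith
      also have "\<dots> \<le> c * ((\<bar>\<kappa>\<bar> + \<bar>\<kappa>'\<bar>) + (\<bar>\<kappa>\<bar> + \<bar>\<kappa>'\<bar>)) * I"
        unfolding I_def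
        by (intro mult_right_mono mult_left_mono add_mono mass v f c(1)) simp
      also have "\<dots> = 2 * c * (\<bar>\<kappa>\<bar> + \<bar>\<kappa>'\<bar>) * I"
        by (simp add: algebra_simps)
      finally show "2 * pi * (?R (?W v) (?W v) - ?R (?W f) (?W f))
          \<le> 2 * pi * (2 * c * (\<bar>\<kappa>\<bar> + \<bar>\<kappa>'\<bar>) * I)"
        by (intro mult_left_mono) auto
    qed
    also have "\<dots> = C * I"
      by (simp add: C_def algebra_simps)
    finally show ?thesis
      unfolding I_def by simp
  qed
  moreover have "0 \<le> C"
    unfolding C_def using c(1) \<beta>(1) by (intro add_nonneg_nonneg mult_nonneg_nonneg) auto
  ultimately show ?thesis by blast
qed

lemma vortex_diameter:
  fixes a b :: "real^2"
  assumes D: "open D" "bounded D" and green: "green_function D G h"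
    and balls: "cball a \<delta> \<subseteq> D" "cball b \<delta> \<subseteq> D" "cball a \<delta> \<inter> cball b \<delta> = {}" "0 < \<delta>"
    and \<kappa>: "\<kappa> \<noteq> 0" "\<kappa>' \<noteq> 0"
  shows "\<exists>R>1. \<exists>lam0>0. \<forall>lam\<ge>lam0. \<forall>f g w.
    vortex_density (ball a \<delta>) lam \<bar>\<kappa>\<bar> f \<longrightarrow> vortex_density (ball b \<delta>) lam \<bar>\<kappa>'\<bar> g \<longrightarrow>
    (AE x in lebesgue_on D. w x = sgn \<kappa> * f x + sgn \<kappa>' * g x) \<longrightarrow>
    (\<forall>v. vortex_density (ball a \<delta>) lam \<bar>\<kappa>\<bar> v \<longrightarrow>
      kinetic_energy D G (\<lambda>x. sgn \<kappa> * v x + sgn \<kappa>' * g x) \<le> kinetic_energy D G w) \<longrightarrow>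
    diameter (ess_support D (\<lambda>x. w x * indicator (ball a \<delta>) x)) < R * sqrt (\<bar>\<kappa>\<bar> / (lam * pi))"
proof -
  define m where "m = \<bar>\<kappa>\<bar>"
  have m: "0 < m" using \<kappa> by (simp add: m_def)
  obtain C where C: "0 \<le> C" and gap: "\<And>lam f g w v.
    vortex_density (ball a \<delta>) lam \<bar>\<kappa>\<bar> f \<Longrightarrow> vortex_density (ball b \<delta>) lam \<bar>\<kappa>'\<bar> g \<Longrightarrow>
    (AE x in lebesgue_on D. w x = sgn \<kappa> * f x + sgn \<kappa>' * g x) \<Longrightarrow>
    (\<forall>v. vortex_density (ball a \<delta>) lam \<bar>\<kappa>\<bar> v \<longrightarrow>
      kinetic_energy D G (\<lambda>x. sgn \<kappa> * v x + sgn \<kappa>' * g x) \<le> kinetic_energy D G w) \<Longrightarrow>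
    vortex_density (ball a \<delta>) lam \<bar>\<kappa>\<bar> v \<Longrightarrow>
    log_energy 1 v v \<le> log_energy 1 f f + C * (\<integral>x. \<bar>v x - f x\<bar> \<partial>lborel)"
    using kinetic_energy_almost_maximizer[OF D green balls(1-3) \<kappa>] by blast
  \<comment> \<open>This is \<open>potential_floor\<close>, written out because R must be chosen
    before \<open>lam\<close>, \<open>e\<close> and \<open>f\<close> are available for the
    locale.\<close>
  define P where "P = (ln 2 + ln 4 + 4) * m + 3 * C"
  define R where "R = exp (2 * (2 * m + P) / m + 1)"
  have "0 \<le> P"
    unfolding P_def using m C by (intro add_nonneg_nonneg mult_nonneg_nonneg) auto
  then have "1 \<le> R"
    using m by (simp add: R_def)
  moreover have "ln R * m = 2 * (2 * m + P) + m"
    using m by (simp add: R_def field_simps)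
  ultimately have R: "1 \<le> R" "2 * (2 * m + P) < ln R * m"
    using m by simp_all
  \<comment> \<open>Exactly the threshold for 3 e \<le> 2 \<delta>.\<close>
  define lam0 where "lam0 = 9 * m / (4 * pi * \<delta>\<^sup>2)"
  have "0 < lam0"
    using m balls(4) by (simp add: lam0_def)
  \<comment> \<open>The distance bound is 2 R e; the additional 1 makes the inequality
    strict.\<close>
  have "diameter (ess_support D (\<lambda>x. w x * indicator (ball a \<delta>) x)) < (2 * R + 1) * sqrt (\<bar>\<kappa>\<bar> / (lam * pi))"
    if lam: "lam0 \<le> lam" and f: "vortex_density (ball a \<delta>) lam \<bar>\<kappa>\<bar> f"
      and g: "vortex_density (ball b \<delta>) lam \<bar>\<kappa>'\<bar> g"
      and w: "AE x in lebesgue_on D. w x = sgn \<kappa> * f x + sgn \<kappa>' * g x"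
      and max: "\<forall>v. vortex_density (ball a \<delta>) lam \<bar>\<kappa>\<bar> v \<longrightarrow>
        kinetic_energy D G (\<lambda>x. sgn \<kappa> * v x + sgn \<kappa>' * g x) \<le> kinetic_energy D G w" for lam f g w
  proof -
    have lam_pos: "0 < lam" using lam \<open>0 < lam0\<close> by simp
    define e where "e = sqrt (m / (lam * pi))"
    have e: "0 < e" "e\<^sup>2 = m / (lam * pi)"
      using m lam_pos by (auto simp: e_def)
    have e_m: "lam * pi * e\<^sup>2 = m"
      using lam_pos e by simp
    have "9 * m \<le> 4 * pi * \<delta>\<^sup>2 * lam"
      using lam balls(4) by (simp add: lam0_def divide_le_eq mult.commute)
    then have "9 * e\<^sup>2 \<le> 4 * \<delta>\<^sup>2"
      unfolding e(2) using lam_pos by (simp add: divide_le_eq mult_ac)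
    then have "(3 * e)\<^sup>2 \<le> (2 * \<delta>)\<^sup>2"
      by (simp add: power_mult_distrib)
    then have e_le: "3 * e \<le> 2 * \<delta>"
      by (rule power2_le_imp_le) (use balls(4) in simp)
    \<comment> \<open>The comparison is available for the kernel with parameter 1. Equal masses let
      \<open>log_energy_scale\<close> carry it over to \<open>e\<close> with the same C.\<close>
    interpret almost_maximizer a \<delta> lam m e C f
    proof
      show "log_energy e v v \<le> log_energy e f f + C * (\<integral>x. \<bar>v x - f x\<bar> \<partial>lborel)"
        if v: "vortex_density (ball a \<delta>) lam m v" for v
      proof -
        have f': "vortex_density (ball a \<delta>) lam m f"
          using f by (simp add: m_def)
        have "log_energy 1 v v \<le> log_energy 1 f f + C * (\<integral>x. \<bar>v x - f x\<bar> \<partial>lborel)"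
          using v unfolding m_def by (rule gap[OF f g w max])
        then show ?thesis
          using log_energy_scale[OF e(1) vortex_density_bdd_bsupp[OF v bounded_ball]]
            log_energy_scale[OF e(1) vortex_density_bdd_bsupp[OF f' bounded_ball]]
            vortex_densityD(5)[OF v] vortex_densityD(5)[OF f'] by simp
      qed
    qed (use e e_le e_m lam_pos C f in \<open>auto simp: m_def\<close>)
    have D_borel: "D \<in> sets borel" using D(1) by auto
    have w': "AE x in lborel. x \<in> D \<longrightarrow> w x = sgn \<kappa> * f x + sgn \<kappa>' * g x"
      using w unfolding AE_lebesgue_on_iff_lborel[OF D_borel] .
    \<comment> \<open>The discs are disjoint, so on \<open>ball a \<delta>\<close> the maximizer
      equals sgn \<kappa> * f almost everywhere, and its essential support there is seen by
      \<open>f\<close>.\<close>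
    have supp: "\<not> (AE z in lborel. z \<in> ball x r \<longrightarrow> f z = 0)"
      if x: "x \<in> ess_support D (\<lambda>x. w x * indicator (ball a \<delta>) x)" and "0 < r" for x r
    proof
      assume "AE z in lborel. z \<in> ball x r \<longrightarrow> f z = 0"
      with w' have "AE z in lborel. z \<in> D \<longrightarrow> z \<in> ball x r \<longrightarrow> w z * indicator (ball a \<delta>) z = 0"
      proof eventually_elim
        case (elim z)
        have "g z = 0" if "z \<in> ball a \<delta>"
        proof (rule vortex_densityD(4)[OF g])
          show "z \<notin> ball b \<delta>"
            using that balls(3) ball_subset_cball[of a \<delta>] ball_subset_cball[of b \<delta>] by blast
        qed
        with elim show ?case by (auto simp: indicator_def)
      qed
      then have "AE z in lebesgue_on D. z \<in> ball x r \<longrightarrow> w z * indicator (ball a \<delta>) z = 0"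
        unfolding AE_lebesgue_on_iff_lborel[OF D_borel] .
      with x \<open>0 < r\<close> show False
        unfolding ess_support_def by blast
    qed
    have "dist x y \<le> 2 * R * e"
      if "x \<in> ess_support D (\<lambda>x. w x * indicator (ball a \<delta>) x)"
        "y \<in> ess_support D (\<lambda>x. w x * indicator (ball a \<delta>) x)" for x y
      using R supp[OF that(1)] supp[OF that(2)]
      by (intro dist_support_le) (auto simp: potential_floor_def P_def)
    then have "diameter (ess_support D (\<lambda>x. w x * indicator (ball a \<delta>) x)) \<le> 2 * R * e"
      using e(1) R(1) by (intro diameter_le) (auto simp: dist_norm)
    also have "\<dots> < (2 * R + 1) * e"
      using e(1) by (simp add: algebra_simps)
    finally show ?thesis
      by (simp add: e_def m_def)
  qed
  moreover have "1 < 2 * R + 1" using R(1) by simp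
  ultimately show ?thesis
    using \<open>0 < lam0\<close> by blast
qed

theorem lemma3p7:
  fixes D :: "(real^2) set"
    and G h :: "real^2 \<Rightarrow> real^2 \<Rightarrow> real"
    and \<kappa>1 \<kappa>2 \<delta> :: real
    and a1 a2 :: "real^2"
  assumes "open D" "connected D" "bounded D" "simply_connected D" "smooth_boundary D"
    and "green_function D G h"
    and "\<kappa>1 > 0" "\<kappa>2 < 0"
    and "a1 \<in> D" "a2 \<in> D" "a1 \<noteq> a2"
    and strict_local_min:
      "\<exists>r>0. \<forall>x1\<in>D. \<forall>x2\<in>D. x1 \<noteq> x2 \<longrightarrow> (x1, x2) \<noteq> (a1, a2) \<longrightarrow> dist (x1, x2) (a1, a2) < r \<longrightarrow>
         kirchhoff_routh G h \<kappa>1 \<kappa>2 a1 a2 < kirchhoff_routh G h \<kappa>1 \<kappa>2 x1 x2"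
    and "\<delta> > 0" "cball a1 \<delta> \<subseteq> D" "cball a2 \<delta> \<subseteq> D" "cball a1 \<delta> \<inter> cball a2 \<delta> = {}"
    and unique_min:
      "\<forall>x1\<in>cball a1 \<delta>. \<forall>x2\<in>cball a2 \<delta>. (x1, x2) \<noteq> (a1, a2) \<longrightarrow>
         kirchhoff_routh G h \<kappa>1 \<kappa>2 a1 a2 < kirchhoff_routh G h \<kappa>1 \<kappa>2 x1 x2"
    and levels_pos:
      "\<exists>\<Lambda>. \<forall>lam\<ge>\<Lambda>. \<forall>w. energy_maximizer D G (ball a1 \<delta>) (ball a2 \<delta>) \<kappa>1 \<kappa>2 lam w \<longrightarrow>
         (\<forall>\<mu>. patch_level D G (ball a1 \<delta>) \<kappa>1 lam w \<mu> \<longrightarrow> \<mu> > 0) \<and>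
         (\<forall>\<mu>. patch_level D G (ball a2 \<delta>) \<kappa>2 lam w \<mu> \<longrightarrow> \<mu> > 0)"
  shows "\<exists>R>1. \<exists>lam0>0. \<forall>lam\<ge>lam0. \<forall>w.
           energy_maximizer D G (ball a1 \<delta>) (ball a2 \<delta>) \<kappa>1 \<kappa>2 lam w \<longrightarrow>
           diameter (ess_support D (\<lambda>x. w x * indicator (ball a1 \<delta>) x))
             < R * sqrt (\<bar>\<kappa>1\<bar> / (lam * pi)) \<and>
           diameter (ess_support D (\<lambda>x. w x * indicator (ball a2 \<delta>) x))
             < R * sqrt (\<bar>\<kappa>2\<bar> / (lam * pi))"
proof -
  let ?e1 = "\<lambda>lam. sqrt (\<bar>\<kappa>1\<bar> / (lam * pi))" and ?e2 = "\<lambda>lam. sqrt (\<bar>\<kappa>2\<bar> / (lam * pi))"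
  have D: "open D" "bounded D" and green: "green_function D G h"
    and balls: "cball a1 \<delta> \<subseteq> D" "cball a2 \<delta> \<subseteq> D" "cball a1 \<delta> \<inter> cball a2 \<delta> = {}"
    and \<delta>: "0 < \<delta>" and \<kappa>: "\<kappa>1 \<noteq> 0" "\<kappa>2 \<noteq> 0"
    using assms by auto
  have balls': "cball a2 \<delta> \<inter> cball a1 \<delta> = {}" using balls(3) by blast
  obtain R1 lam1 where 1: "1 < R1" "0 < lam1" "\<And>lam f g w. lam1 \<le> lam \<Longrightarrow>
      vortex_density (ball a1 \<delta>) lam \<bar>\<kappa>1\<bar> f \<Longrightarrow> vortex_density (ball a2 \<delta>) lam \<bar>\<kappa>2\<bar> g \<Longrightarrow>
      (AE x in lebesgue_on D. w x = sgn \<kappa>1 * f x + sgn \<kappa>2 * g x) \<Longrightarrow>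
      (\<forall>v. vortex_density (ball a1 \<delta>) lam \<bar>\<kappa>1\<bar> v \<longrightarrow>
        kinetic_energy D G (\<lambda>x. sgn \<kappa>1 * v x + sgn \<kappa>2 * g x) \<le> kinetic_energy D G w) \<Longrightarrow>
      diameter (ess_support D (\<lambda>x. w x * indicator (ball a1 \<delta>) x)) < R1 * ?e1 lam"
    using vortex_diameter[OF D green balls \<delta> \<kappa>] by blast
  \<comment> \<open>The same result with the vortices exchanged: now the first one is
    frozen.\<close>
  obtain R2 lam2 where 2: "1 < R2" "0 < lam2" "\<And>lam f g w. lam2 \<le> lam \<Longrightarrow>
      vortex_density (ball a2 \<delta>) lam \<bar>\<kappa>2\<bar> f \<Longrightarrow> vortex_density (ball a1 \<delta>) lam \<bar>\<kappa>1\<bar> g \<Longrightarrow>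
      (AE x in lebesgue_on D. w x = sgn \<kappa>2 * f x + sgn \<kappa>1 * g x) \<Longrightarrow>
      (\<forall>v. vortex_density (ball a2 \<delta>) lam \<bar>\<kappa>2\<bar> v \<longrightarrow>
        kinetic_energy D G (\<lambda>x. sgn \<kappa>2 * v x + sgn \<kappa>1 * g x) \<le> kinetic_energy D G w) \<Longrightarrow>
      diameter (ess_support D (\<lambda>x. w x * indicator (ball a2 \<delta>) x)) < R2 * ?e2 lam"
    using vortex_diameter[OF D green balls(2,1) balls' \<delta> \<kappa>(2,1)] by blast
  define R where "R = max R1 R2"
  have "diameter (ess_support D (\<lambda>x. w x * indicator (ball a1 \<delta>) x)) < R * ?e1 lam \<and>
      diameter (ess_support D (\<lambda>x. w x * indicator (ball a2 \<delta>) x)) < R * ?e2 lam"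
    if lam: "max lam1 lam2 \<le> lam" and max: "energy_maximizer D G (ball a1 \<delta>) (ball a2 \<delta>) \<kappa>1 \<kappa>2 lam w" for lam w
  proof -
    have lam_nonneg: "0 \<le> lam" using lam 1(2) by linarith
    have D_borel: "D \<in> sets borel" using D(1) by auto
    have sub: "ball a1 \<delta> \<subseteq> D" "ball a2 \<delta> \<subseteq> D"
      using balls(1,2) ball_subset_cball by blast+
    obtain w1 w2 where w: "w = (\<lambda>x. w1 x + w2 x)"
      "w1 \<in> signed_vorticities D (ball a1 \<delta>) \<kappa>1 lam" "w2 \<in> signed_vorticities D (ball a2 \<delta>) \<kappa>2 lam"
      using max unfolding energy_maximizer_def admissible_def by blast
    obtain f1 where f1: "vortex_density (ball a1 \<delta>) lam \<bar>\<kappa>1\<bar> f1" "AE x in lebesgue_on D. w1 x = sgn \<kappa>1 * f1 x"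
      using signed_vorticity_obtain_density[OF w(2) D_borel borel_open[OF open_ball] sub(1) \<kappa>(1) lam_nonneg] by blast
    obtain f2 where f2: "vortex_density (ball a2 \<delta>) lam \<bar>\<kappa>2\<bar> f2" "AE x in lebesgue_on D. w2 x = sgn \<kappa>2 * f2 x"
      using signed_vorticity_obtain_density[OF w(3) D_borel borel_open[OF open_ball] sub(2) \<kappa>(2) lam_nonneg] by blast
    have w12: "AE x in lebesgue_on D. w x = sgn \<kappa>1 * f1 x + sgn \<kappa>2 * f2 x"
      using f1(2) f2(2) by eventually_elim (simp add: w(1))
    then have w21: "AE x in lebesgue_on D. w x = sgn \<kappa>2 * f2 x + sgn \<kappa>1 * f1 x"
      by (simp add: add.commute)
    have le: "kinetic_energy D G (\<lambda>x. sgn \<kappa>1 * v1 x + sgn \<kappa>2 * v2 x) \<le> kinetic_energy D G w"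
      if "vortex_density (ball a1 \<delta>) lam \<bar>\<kappa>1\<bar> v1" "vortex_density (ball a2 \<delta>) lam \<bar>\<kappa>2\<bar> v2" for v1 v2
    proof -
      have "(\<lambda>x. sgn \<kappa>1 * v1 x + sgn \<kappa>2 * v2 x) \<in> admissible D (ball a1 \<delta>) (ball a2 \<delta>) \<kappa>1 \<kappa>2 lam"
        unfolding admissible_def mem_Collect_eq
        by (intro exI[of _ "\<lambda>x. sgn \<kappa>1 * v1 x"] exI[of _ "\<lambda>x. sgn \<kappa>2 * v2 x"] conjI refl
          vortex_density_signed_vorticity D_borel sub \<kappa> that)
      then show ?thesis
        using max unfolding energy_maximizer_def by blast
    qed
    have "diameter (ess_support D (\<lambda>x. w x * indicator (ball a1 \<delta>) x)) < R1 * ?e1 lam"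
      using le f2(1) lam by (intro 1(3)[OF _ f1(1) f2(1) w12]) auto
    also have "\<dots> \<le> R * ?e1 lam"
      unfolding R_def using lam_nonneg by (intro mult_right_mono) auto
    finally have "diameter (ess_support D (\<lambda>x. w x * indicator (ball a1 \<delta>) x)) < R * ?e1 lam" .
    moreover have "diameter (ess_support D (\<lambda>x. w x * indicator (ball a2 \<delta>) x)) < R2 * ?e2 lam"
      using le f1(1) lam by (intro 2(3)[OF _ f2(1) f1(1) w21]) (auto simp: add.commute)
    then have "diameter (ess_support D (\<lambda>x. w x * indicator (ball a2 \<delta>) x)) < R * ?e2 lam"
    proof (rule less_le_trans)
      show "R2 * ?e2 lam \<le> R * ?e2 lam"
        unfolding R_def using lam_nonneg by (intro mult_right_mono) auto
    qed
    ultimately show ?thesis ..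
  qed
  moreover have "1 < R" "0 < max lam1 lam2"
    using 1(1,2) by (auto simp: R_def)
  ultimately show ?thesis by blast
qed

end
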